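(* Let $1\le p\le n$. If $p\in\{1,2,n-2,n-1,n\}$, then $\mathcal C^n_p[k]$ is independent of the characteristic of the field $k$, i.e. $\mathcal C^n_p[k]=\mathcal C^n_p[k']$ for all fields $k,k'$. If $3\le p\le n-3$, then $\mathcal C^n_p[k]$ depends on the characteristic of $k$, i.e. there exist fields $k,k'$ of different characteristics with $\mathcal C^n_p[k]\ne\mathcal C^n_p[k']$.
   Context: Let $[n]=\{1,\dots,n\}$ and let $\binom{[n]}{p}$ be the set of $p$-element subsets of $[n]$. For $1\le p<n$ let $M(n,p)$ be the matrix over $k$ with rows indexed by $\binom{[n]}{p}$ and columns indexed by $\binom{[n]}{p+1}$, with $(\sigma,\tau)$ entry equal to $0$ if $\sigma\not\subset\tau$ and, if $\sigma\subset\tau$ with $\tau\setminus\sigma=\{j\}$, equal to $(-1)^{\#\{s\in\tau:\,s<j\}}$. $\mathcal C^n_p[k]$ is the collection of all $C\subset\binom{[n]}{p}$ such that the rows of $M(n,p)$ indexed by $C$ form a minimal linearly dependent set over $k$. For $p=n$ the matrix $M(n,n)$ has one row and no columns, so that $\mathcal C^n_n[k]=\{\{[n]\}\}$. *)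

theory Defs
  imports "HOL-Algebra.Ring"
begin

text \<open>
  Fields are HOL-Algebra fields, so that one can quantify over them inside a formula.
\<close>

definition subsets_of_card :: "nat \<Rightarrow> nat \<Rightarrow> nat set set" where
  "subsets_of_card n p = {\<sigma>. \<sigma> \<subseteq> {1..n} \<and> card \<sigma> = p}"

definition ring_char :: "('a, 'm) ring_scheme \<Rightarrow> nat" where
  "ring_char K =
     (if \<exists>m>0. add_pow K (m::nat) \<one>\<^bsub>K\<^esub> = \<zero>\<^bsub>K\<^esub>
      then LEAST m. m > 0 \<and> add_pow K m \<one>\<^bsub>K\<^esub> = \<zero>\<^bsub>K\<^esub>
      else 0)"

text \<open>
  The \<open>(\<sigma>, \<tau>)\<close> entry of \<open>M(n,p)\<close>. The formula does not involve \<open>n\<close> and \<open>p\<close>; these only determine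
  the index sets \<open>\<sigma> \<in> subsets_of_card n p\<close> and \<open>\<tau> \<in> subsets_of_card n (p + 1)\<close>, on which
  \<open>\<sigma> \<subseteq> \<tau>\<close> implies that \<open>\<tau> - \<sigma>\<close> is a singleton.
\<close>

definition M_entry :: "('a, 'm) ring_scheme \<Rightarrow> nat set \<Rightarrow> nat set \<Rightarrow> 'a" where
  "M_entry K \<sigma> \<tau> =
     (if \<sigma> \<subseteq> \<tau>
      then (\<ominus>\<^bsub>K\<^esub> \<one>\<^bsub>K\<^esub>) [^]\<^bsub>K\<^esub> card {s \<in> \<tau>. s < the_elem (\<tau> - \<sigma>)}
      else \<zero>\<^bsub>K\<^esub>)"

text \<open>
  Linear dependence of the rows of \<open>M(n,p)\<close> indexed by \<open>C\<close>. Rows are treated as a family: distinct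
  indices count as distinct even if the rows are equal as vectors (as happens for \<open>p = n - 1\<close>).
  For \<open>p = n\<close> there are no columns, so the condition on the columns is vacuous.
\<close>

definition rows_dependent :: "('a, 'm) ring_scheme \<Rightarrow> nat \<Rightarrow> nat \<Rightarrow> nat set set \<Rightarrow> bool" where
  "rows_dependent K n p C \<longleftrightarrow>
     (\<exists>c \<in> C \<rightarrow> carrier K.
        (\<exists>\<sigma>\<in>C. c \<sigma> \<noteq> \<zero>\<^bsub>K\<^esub>) \<and>
        (\<forall>\<tau> \<in> subsets_of_card n (p + 1). (\<Oplus>\<^bsub>K\<^esub>\<sigma>\<in>C. c \<sigma> \<otimes>\<^bsub>K\<^esub> M_entry K \<sigma> \<tau>) = \<zero>\<^bsub>K\<^esub>))"

definition circuits :: "('a, 'm) ring_scheme \<Rightarrow> nat \<Rightarrow> nat \<Rightarrow> nat set set set" where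
  "circuits K n p =
     {C. C \<subseteq> subsets_of_card n p \<and> rows_dependent K n p C \<and> (\<forall>D. D \<subset> C \<longrightarrow> \<not> rows_dependent K n p D)}"

lemma circuits_top:
  assumes "field K"
  shows "circuits K n n = {{{1..n}}}"
proof -
  interpret field K by fact
  have n: "subsets_of_card n n = {{1..n}}"
  proof (intro equalityI subsetI)
    fix S assume "S \<in> subsets_of_card n n"
    then have "S \<subseteq> {1..n}" "card S = n" by (simp_all add: subsets_of_card_def)
    then have "S = {1..n}" by (intro card_subset_eq) simp_all
    then show "S \<in> {{1..n}}" by (simp only: singleton_iff)
  qed (simp add: subsets_of_card_def)
  have cols: "subsets_of_card n (n + 1) = {}"
  proof (rule equals0I)
    fix S assume "S \<in> subsets_of_card n (n + 1)"
    then have "S \<subseteq> {1..n}" "card S = n + 1" by (simp_all add: subsets_of_card_def)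
    then show False using card_mono[of "{1..n}" S] by simp
  qed
  have dep: "rows_dependent K n n C \<longleftrightarrow> C \<noteq> {}" for C
  proof
    assume "C \<noteq> {}"
    then show "rows_dependent K n n C"
      unfolding rows_dependent_def cols by (intro bexI[of _ "\<lambda>_. \<one>\<^bsub>K\<^esub>"]) auto
  next
    assume "rows_dependent K n n C"
    then show "C \<noteq> {}" unfolding rows_dependent_def by blast
  qed
  show ?thesis
    unfolding circuits_def n dep by (auto simp: subset_singleton_iff psubset_eq)
qed

end

theory Submission
  imports Defs "HOL-Number_Theory.Residues"
begin

text \<open>
  A linear dependence among the rows of \<open>M(n,p)\<close> is a simplicial cocycle, so that the circuits are
  the minimal supports of nonzero cocycles of the full simplex on \<open>{1..n}\<close>. For \<open>p = 1\<close> the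
  cocycles are the constants. For \<open>p = 2\<close> they are the differences \<open>g j - g i\<close> of vertex functions,
  and the supports contain the edge cuts given by the level sets of \<open>g\<close>. For \<open>p = n - 1\<close> there is
  one column, with entries \<open>\<plusminus>1\<close>. For \<open>p = n - 2\<close> complements turn rows into the edges of a graph and
  cocycles into flows; an edge carries a nonzero flow iff it is not a bridge. None of these
  descriptions involves the field.

  For \<open>3 \<le> p \<le> n - 3\<close> put \<open>m = n - p + 3\<close>. Cochains supported on the \<open>p\<close>-sets containing
  \<open>{m+1..n}\<close> are cochains on the triples in \<open>{1..m}\<close>. Take the edge labelling modulo 2 that is 1 on
  the five edges of the six-vertex real projective plane not lying in the star of vertex 1. Its
  coboundary is a nonzero cocycle over the field with two elements. Over any field, a cocycle with
  at most the same support is determined by its values on the triples consisting of vertex 1 and one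
  of the five edges. The five triangles of the projective plane opposite to vertex 1 make these
  values agree and equal to their own negatives, so they vanish over the field with three elements.
\<close>

subsection \<open>Cocycles of the full simplex\<close>

definition coboundary :: "('a, 'm) ring_scheme \<Rightarrow> (nat set \<Rightarrow> 'a) \<Rightarrow> nat set \<Rightarrow> 'a" where
  "coboundary K c \<tau> =
     (\<Oplus>\<^bsub>K\<^esub>j\<in>\<tau>. (\<ominus>\<^bsub>K\<^esub> \<one>\<^bsub>K\<^esub>) [^]\<^bsub>K\<^esub> card {s \<in> \<tau>. s < j} \<otimes>\<^bsub>K\<^esub> c (\<tau> - {j}))"

text \<open>Cochains are total functions and \<open>C\<close> only bounds their support. So the
  cocycles of different families live in one function space, and enlarging \<open>C\<close> enlarges
  the set.\<close>

definition cocycles :: "('a, 'm) ring_scheme \<Rightarrow> nat \<Rightarrow> nat \<Rightarrow> nat set set \<Rightarrow> (nat set \<Rightarrow> 'a) set" where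
  "cocycles K n p C =
     {c. (\<forall>\<sigma>. c \<sigma> \<in> carrier K) \<and> (\<forall>\<sigma>. \<sigma> \<notin> C \<longrightarrow> c \<sigma> = \<zero>\<^bsub>K\<^esub>) \<and>
         (\<forall>\<tau>\<in>subsets_of_card n (p + 1). coboundary K c \<tau> = \<zero>\<^bsub>K\<^esub>)}"

lemma finite_subsets_of_card: "finite (subsets_of_card n p)"
  by (rule finite_subset[of _ "Pow {1..n}"]) (auto simp: subsets_of_card_def)

lemma subsets_of_card_finite: "\<sigma> \<in> subsets_of_card n p \<Longrightarrow> finite \<sigma>"
  by (auto simp: subsets_of_card_def intro: finite_subset)

section \<open>Signs and finite sums in a ring\<close>

context ring
begin

abbreviation sgn_pow :: "nat \<Rightarrow> 'a" where
  "sgn_pow k \<equiv> (\<ominus> \<one>) [^] k"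

lemma sgn_pow_even: "even k \<Longrightarrow> sgn_pow k = \<one>"
proof -
  assume "even k"
  then obtain m where "k = 2 * m" by (elim evenE)
  moreover have "sgn_pow 2 = \<one>" by (simp add: numeral_2_eq_2 l_minus)
  ultimately show ?thesis by (simp flip: nat_pow_pow)
qed

lemma sgn_pow_odd: "odd k \<Longrightarrow> sgn_pow k = \<ominus> \<one>"
  by (auto elim!: oddE simp: sgn_pow_even)

text \<open>A power of -1 is its own inverse. The case \<open>y = \<zero>\<close> cancels a sign
  without assuming an integral domain.\<close>

lemma sgn_pow_mult_eq:
  assumes "x \<in> carrier R" "y \<in> carrier R"
  shows "sgn_pow k \<otimes> x = y \<longleftrightarrow> x = sgn_pow k \<otimes> y"
  using assms by (cases "even k") (auto simp: sgn_pow_even sgn_pow_odd l_minus)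

lemma finsum_support:
  assumes "finite A" "B \<subseteq> A" "\<And>x. x \<in> A - B \<Longrightarrow> f x = \<zero>" "\<And>x. x \<in> B \<Longrightarrow> f x \<in> carrier R"
  shows "(\<Oplus>x\<in>A. f x) = (\<Oplus>x\<in>B. f x)"
proof (rule add.finprod_mono_neutral_cong_right)
  show "f \<in> A \<rightarrow> carrier R"
  proof
    fix x assume "x \<in> A"
    then show "f x \<in> carrier R" using assms(3,4)[of x] by (cases "x \<in> B") auto
  qed
qed (use assms in auto)

lemma finsum_single:
  assumes "finite A" "a \<in> A" "\<And>x. x \<in> A \<Longrightarrow> x \<noteq> a \<Longrightarrow> f x = \<zero>" "f a \<in> carrier R"
  shows "(\<Oplus>x\<in>A. f x) = f a"
proof -
  have "(\<Oplus>x\<in>A. f x) = (\<Oplus>x\<in>{a}. f x)"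
    by (rule finsum_support) (use assms in auto)
  then show ?thesis using assms by simp
qed

lemma finsum_pair:
  assumes "finite A" "a \<in> A" "b \<in> A" "a \<noteq> b" "\<And>x. x \<in> A \<Longrightarrow> x \<noteq> a \<Longrightarrow> x \<noteq> b \<Longrightarrow> f x = \<zero>"
    "f a \<in> carrier R" "f b \<in> carrier R"
  shows "(\<Oplus>x\<in>A. f x) = f a \<oplus> f b"
proof -
  have "(\<Oplus>x\<in>A. f x) = (\<Oplus>x\<in>{a, b}. f x)"
    by (rule finsum_support) (use assms in auto)
  then show ?thesis using assms by simp
qed

text \<open>Adding a point to \<open>S\<close> adds one row and one column, whose entries cancel in
  pairs. The vanishing diagonal is a separate assumption because antisymmetry does not imply it in
  characteristic 2.\<close>

lemma finsum_alternating:
  assumes "finite S" "\<And>u v. f u v \<in> carrier R" "\<And>u v. f u v = \<ominus> f v u" "\<And>u. f u u = \<zero>"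
  shows "(\<Oplus>u\<in>S. \<Oplus>v\<in>S. f u v) = \<zero>"
  using assms(1)
proof induction
  case (insert x S)
  have "(\<Oplus>u\<in>S. f x u \<oplus> f u x) = \<zero>"
    using assms(3)[of x] assms(2) by (intro add.finprod_one_eqI) (simp add: l_neg)
  then have z: "(\<Oplus>u\<in>S. f x u) \<oplus> (\<Oplus>u\<in>S. f u x) = \<zero>"
    by (subst (asm) finsum_addf) (auto simp: assms(2))
  have "(\<Oplus>u\<in>insert x S. \<Oplus>v\<in>insert x S. f u v) =
      (\<Oplus>u\<in>S. f x u) \<oplus> (\<Oplus>u\<in>S. f u x \<oplus> (\<Oplus>v\<in>S. f u v))"
    using insert(1,2) assms(2,4) by (simp add: Pi_def a_ac)
  also have "\<dots> = (\<Oplus>u\<in>S. f x u) \<oplus> (\<Oplus>u\<in>S. f u x)"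
    using insert assms(2) by (subst finsum_addf) (auto simp: Pi_def)
  finally show ?case using z by simp
qed simp

lemma M_entry_carrier: "M_entry R \<sigma> \<tau> \<in> carrier R"
  by (auto simp: M_entry_def)

end

text \<open>The sum passes through the union of \<open>C\<close> with the set of facets of
  \<open>\<tau>\<close>: \<open>c\<close> vanishes off \<open>C\<close>, and the matrix entry
  vanishes on members of \<open>C\<close> that are not facets.\<close>

lemma (in cring) rows_sum_eq_coboundary:
  assumes C: "C \<subseteq> subsets_of_card n p" and \<tau>: "\<tau> \<in> subsets_of_card n (p + 1)"
    and c: "\<And>\<sigma>. c \<sigma> \<in> carrier R" "\<And>\<sigma>. \<sigma> \<notin> C \<Longrightarrow> c \<sigma> = \<zero>"
  shows "(\<Oplus>\<sigma>\<in>C. c \<sigma> \<otimes> M_entry R \<sigma> \<tau>) = coboundary R c \<tau>"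
proof -
  let ?f = "\<lambda>\<sigma>. c \<sigma> \<otimes> M_entry R \<sigma> \<tau>"
  let ?D = "(\<lambda>j. \<tau> - {j}) ` \<tau>"
  have fin: "finite \<tau>" using \<tau> by (rule subsets_of_card_finite)
  have finC: "finite C" using C finite_subsets_of_card finite_subset by blast
  have D: "\<sigma> \<in> ?D" if "\<sigma> \<in> C" "\<sigma> \<subseteq> \<tau>" for \<sigma>
  proof -
    have "card (\<tau> - \<sigma>) = 1"
      using that C \<tau> by (subst card_Diff_subset) (auto simp: subsets_of_card_def intro: finite_subset)
    then obtain j where "\<tau> - \<sigma> = {j}" by (auto simp: card_1_singleton_iff)
    then have "j \<in> \<tau>" "\<sigma> = \<tau> - {j}" using that by auto
    then show ?thesis by blast
  qed
  have "(\<Oplus>\<sigma>\<in>C. ?f \<sigma>) = (\<Oplus>\<sigma>\<in>C \<union> ?D. ?f \<sigma>)"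
    by (rule finsum_support[symmetric])
      (use fin finC c M_entry_carrier in auto)
  also have "\<dots> = (\<Oplus>\<sigma>\<in>?D. ?f \<sigma>)"
    by (rule finsum_support) (use fin finC c M_entry_carrier D in \<open>auto simp: M_entry_def\<close>)
  also have "\<dots> = (\<Oplus>j\<in>\<tau>. ?f (\<tau> - {j}))"
    by (rule finsum_reindex) (auto simp: c M_entry_carrier inj_on_def)
  also have "\<dots> = coboundary R c \<tau>"
    unfolding coboundary_def
  proof (rule finsum_cong')
    fix j assume "j \<in> \<tau>"
    then have "\<tau> - (\<tau> - {j}) = {j}" by auto
    then show "?f (\<tau> - {j}) = sgn_pow (card {s \<in> \<tau>. s < j}) \<otimes> c (\<tau> - {j})"
      by (simp add: M_entry_def m_comm c)
  qed (auto simp: c)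
  finally show ?thesis .
qed

text \<open>Coefficients given on \<open>C\<close> are extended by zero. A nonzero value then sits
  in \<open>C\<close> automatically.\<close>

lemma (in cring) rows_dependent_iff:
  assumes C: "C \<subseteq> subsets_of_card n p"
  shows "rows_dependent R n p C \<longleftrightarrow> (\<exists>c\<in>cocycles R n p C. \<exists>\<sigma>. c \<sigma> \<noteq> \<zero>)"
proof
  assume "rows_dependent R n p C"
  then obtain c \<sigma> where c: "c \<in> C \<rightarrow> carrier R" "\<sigma> \<in> C" "c \<sigma> \<noteq> \<zero>"
    and z: "\<And>\<tau>. \<tau> \<in> subsets_of_card n (p + 1) \<Longrightarrow> (\<Oplus>\<sigma>\<in>C. c \<sigma> \<otimes> M_entry R \<sigma> \<tau>) = \<zero>"
    unfolding rows_dependent_def by blast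
  define d where "d \<sigma> = (if \<sigma> \<in> C then c \<sigma> else \<zero>)" for \<sigma>
  have d: "d \<sigma> \<in> carrier R" "\<sigma> \<notin> C \<Longrightarrow> d \<sigma> = \<zero>" for \<sigma>
    using c(1) by (auto simp: d_def)
  have "coboundary R d \<tau> = \<zero>" if \<tau>: "\<tau> \<in> subsets_of_card n (p + 1)" for \<tau>
  proof -
    have "(\<Oplus>\<sigma>\<in>C. d \<sigma> \<otimes> M_entry R \<sigma> \<tau>) = (\<Oplus>\<sigma>\<in>C. c \<sigma> \<otimes> M_entry R \<sigma> \<tau>)"
      by (rule finsum_cong') (use c(1) in \<open>auto simp: d_def M_entry_carrier\<close>)
    then show ?thesis
      using rows_sum_eq_coboundary[OF C \<tau>, of d] d z[OF \<tau>] by simp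
  qed
  with c d show "\<exists>c\<in>cocycles R n p C. \<exists>\<sigma>. c \<sigma> \<noteq> \<zero>"
    unfolding cocycles_def by (intro bexI[of _ d] exI[of _ \<sigma>]) (auto simp: d_def)
next
  assume "\<exists>c\<in>cocycles R n p C. \<exists>\<sigma>. c \<sigma> \<noteq> \<zero>"
  then obtain c \<sigma> where c: "\<And>\<sigma>. c \<sigma> \<in> carrier R" "\<And>\<sigma>. \<sigma> \<notin> C \<Longrightarrow> c \<sigma> = \<zero>" "c \<sigma> \<noteq> \<zero>"
    and z: "\<And>\<tau>. \<tau> \<in> subsets_of_card n (p + 1) \<Longrightarrow> coboundary R c \<tau> = \<zero>"
    unfolding cocycles_def by blast
  show "rows_dependent R n p C"
    unfolding rows_dependent_def
    using rows_sum_eq_coboundary[OF C, of _ c] c z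
    by (intro bexI[of _ c] conjI bexI[of _ \<sigma>]) auto
qed

text \<open>Minimality of \<open>C\<close> involves only subsets of \<open>C\<close>. Hence a
  description of dependence that does not mention the field is enough for the first half of the
  theorem.\<close>

lemma circuits_cong:
  assumes "\<And>C. C \<subseteq> subsets_of_card n p \<Longrightarrow> rows_dependent K n p C \<longleftrightarrow> rows_dependent L n p C"
  shows "circuits K n p = circuits L n p"
  using assms unfolding circuits_def by (auto 4 4 dest: psubset_imp_subset order_trans)

text \<open>A dependent family is finite, so it contains a minimal dependent one. Thus the circuits
  determine all dependent families, and one family that is dependent over only one of two fields
  tells their circuits apart.\<close>

lemma (in cring) rows_dependent_iff_circuit:
  assumes "C \<subseteq> subsets_of_card n p"
  shows "rows_dependent R n p C \<longleftrightarrow> (\<exists>D\<in>circuits R n p. D \<subseteq> C)"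
proof
  have "finite C" using assms finite_subsets_of_card finite_subset by blast
  then show "rows_dependent R n p C \<Longrightarrow> \<exists>D\<in>circuits R n p. D \<subseteq> C"
    using assms
  proof (induction C rule: finite_psubset_induct)
    case (psubset C)
    show ?case
    proof (cases "\<exists>D. D \<subset> C \<and> rows_dependent R n p D")
      case True
      then show ?thesis using psubset by (meson psubset_imp_subset order_trans)
    next
      case False
      then have "C \<in> circuits R n p" using psubset by (auto simp: circuits_def)
      then show ?thesis by blast
    qed
  qed
next
  assume "\<exists>D\<in>circuits R n p. D \<subseteq> C"
  then obtain D where D: "D \<subseteq> C" "D \<subseteq> subsets_of_card n p" "rows_dependent R n p D"
    by (auto simp: circuits_def)
  have "cocycles R n p D \<subseteq> cocycles R n p C"
    using D(1) by (auto simp: cocycles_def)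
  then show "rows_dependent R n p C"
    using D rows_dependent_iff[OF D(2)] rows_dependent_iff[OF assms] by auto
qed

section \<open>Coboundaries in low degree and sets of small cardinality\<close>

lemma (in cring) coboundary_2:
  assumes "i < j" "\<And>\<sigma>. c \<sigma> \<in> carrier R"
  shows "coboundary R c {i, j} = c {j} \<ominus> c {i}"
proof -
  have *: "{s. (s = i \<or> s = j) \<and> s < i} = {}" "{s. (s = i \<or> s = j) \<and> s < j} = {i}"
    using assms(1) by auto
  have **: "{i, j} - {i} = {j}" "{i, j} - {j} = {i}" using assms(1) by auto
  show ?thesis
    using assms by (simp add: * ** coboundary_def Pi_def a_minus_def l_minus)
qed

lemma (in cring) coboundary_3:
  assumes "i < j" "j < k" "\<And>\<sigma>. c \<sigma> \<in> carrier R"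
  shows "coboundary R c {i, j, k} = c {j, k} \<ominus> c {i, k} \<oplus> c {i, j}"
proof -
  have *: "{s. (s = i \<or> s = j \<or> s = k) \<and> s < i} = {}" "{s. (s = i \<or> s = j \<or> s = k) \<and> s < j} = {i}"
    "{s. (s = i \<or> s = j \<or> s = k) \<and> s < k} = {i, j}"
    using assms(1,2) by auto
  have **: "{i, j, k} - {i} = {j, k}" "{i, j, k} - {j} = {i, k}" "{i, j, k} - {k} = {i, j}"
    using assms(1,2) by auto
  show ?thesis
    using assms by (simp add: * ** coboundary_def Pi_def a_minus_def l_minus sgn_pow_even a_assoc)
qed

lemma (in cring) coboundary_4:
  assumes "i < j" "j < k" "k < l" "\<And>\<sigma>. c \<sigma> \<in> carrier R"
  shows "coboundary R c {i, j, k, l} = c {j, k, l} \<ominus> c {i, k, l} \<oplus> c {i, j, l} \<ominus> c {i, j, k}"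
proof -
  have *: "{s. (s = i \<or> s = j \<or> s = k \<or> s = l) \<and> s < i} = {}"
    "{s. (s = i \<or> s = j \<or> s = k \<or> s = l) \<and> s < j} = {i}"
    "{s. (s = i \<or> s = j \<or> s = k \<or> s = l) \<and> s < k} = {i, j}"
    "{s. (s = i \<or> s = j \<or> s = k \<or> s = l) \<and> s < l} = {i, j, k}"
    using assms(1-3) by auto
  have **: "{i, j, k, l} - {i} = {j, k, l}" "{i, j, k, l} - {j} = {i, k, l}"
    "{i, j, k, l} - {k} = {i, j, l}" "{i, j, k, l} - {l} = {i, j, k}"
    using assms(1-3) by auto
  show ?thesis
    using assms by (simp add: * ** coboundary_def Pi_def a_minus_def l_minus sgn_pow_even sgn_pow_odd a_assoc)
qed

lemma doubletonE_less:
  fixes e :: "'a :: linorder set"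
  assumes "card e = 2"
  obtains u v where "u < v" "e = {u, v}"
  using assms unfolding card_2_iff by (metis insert_commute neqE)

lemma subsets_of_card_pred:
  assumes "1 \<le> n"
  shows "subsets_of_card n (n - 1) = (\<lambda>v. {1..n} - {v}) ` {1..n}"
proof (intro equalityI subsetI)
  fix \<tau> assume \<tau>: "\<tau> \<in> subsets_of_card n (n - 1)"
  then have "card ({1..n} - \<tau>) = 1"
    using assms by (subst card_Diff_subset) (auto simp: subsets_of_card_def intro: finite_subset)
  then obtain v where "{1..n} - \<tau> = {v}" by (auto simp: card_1_singleton_iff)
  moreover have "\<tau> \<subseteq> {1..n}" using \<tau> by (simp add: subsets_of_card_def)
  ultimately have "v \<in> {1..n}" "\<tau> = {1..n} - {v}" by auto
  then show "\<tau> \<in> (\<lambda>v. {1..n} - {v}) ` {1..n}" by blast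
qed (use assms in \<open>auto simp: subsets_of_card_def\<close>)

lemma card_3_less:
  fixes e :: "'a :: linorder set"
  assumes "card e = 3"
  obtains u v w where "u < v" "v < w" "e = {u, v, w}"
proof -
  have fin: "finite e" "e \<noteq> {}" using assms by (auto intro: card_ge_0_finite)
  have "card (e - {Min e}) = 2" using assms fin by simp
  then obtain v w where vw: "v < w" "e - {Min e} = {v, w}" by (rule doubletonE_less)
  then have "v \<in> e" "v \<noteq> Min e" by blast+
  then have "Min e < v" using fin by (simp add: order_less_le)
  moreover have "e = {Min e, v, w}" using vw(2) Min_in[OF fin] by blast
  ultimately show ?thesis using vw(1) by (intro that)
qed

lemma subsets_of_card_iff: "\<sigma> \<in> subsets_of_card n p \<longleftrightarrow> \<sigma> \<subseteq> {1..n} \<and> card \<sigma> = p"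
  by (simp add: subsets_of_card_def)

lemma subsets_of_card_1E:
  assumes "\<sigma> \<in> subsets_of_card n 1"
  obtains i where "i \<in> {1..n}" "\<sigma> = {i}"
proof -
  have "card \<sigma> = 1" "\<sigma> \<subseteq> {1..n}" using assms by (simp_all add: subsets_of_card_iff)
  then obtain i where "\<sigma> = {i}" "\<sigma> \<subseteq> {1..n}" by (elim card_1_singletonE)
  then show ?thesis by (intro that[of i]) simp_all
qed

lemma subsets_of_card_2E:
  assumes "\<sigma> \<in> subsets_of_card n 2"
  obtains i j where "1 \<le> i" "i < j" "j \<le> n" "\<sigma> = {i, j}"
proof -
  have "card \<sigma> = 2" "\<sigma> \<subseteq> {1..n}" using assms by (simp_all add: subsets_of_card_iff)
  then obtain i j where "i < j" "\<sigma> = {i, j}" "\<sigma> \<subseteq> {1..n}" by (elim doubletonE_less)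
  then show ?thesis by (intro that[of i j]) simp_all
qed

lemma subsets_of_card_3E:
  assumes "\<sigma> \<in> subsets_of_card n 3"
  obtains i j k where "1 \<le> i" "i < j" "j < k" "k \<le> n" "\<sigma> = {i, j, k}"
proof -
  have "card \<sigma> = 3" "\<sigma> \<subseteq> {1..n}" using assms by (simp_all add: subsets_of_card_iff)
  then obtain i j k where "i < j" "j < k" "\<sigma> = {i, j, k}" "\<sigma> \<subseteq> {1..n}" by (elim card_3_less)
  then show ?thesis by (intro that[of i j k]) simp_all
qed

context cring
begin

lemma cocyclesD:
  assumes "c \<in> cocycles R n p C"
  shows cocycles_carrier: "c \<sigma> \<in> carrier R"
    and cocycles_support: "c \<sigma> \<noteq> \<zero> \<Longrightarrow> \<sigma> \<in> C"
    and cocycles_coboundary: "\<tau> \<in> subsets_of_card n (p + 1) \<Longrightarrow> coboundary R c \<tau> = \<zero>"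
  using assms unfolding cocycles_def by blast+

lemma cocyclesI:
  assumes "\<And>\<sigma>. c \<sigma> \<in> carrier R" "\<And>\<sigma>. c \<sigma> \<noteq> \<zero> \<Longrightarrow> \<sigma> \<in> C"
    "\<And>\<tau>. \<tau> \<in> subsets_of_card n (p + 1) \<Longrightarrow> coboundary R c \<tau> = \<zero>"
  shows "c \<in> cocycles R n p C"
  unfolding cocycles_def using assms by blast

end

subsection \<open>The cases $p = 1$, $p = 2$ and $p = n - 1$\<close>

context cring
begin

text \<open>The column \<open>{i, j}\<close> forces equal values at \<open>i\<close> and
  \<open>j\<close>, so a nonzero cocycle vanishes at no vertex. Conversely, the constant 1 is a
  cocycle.\<close>

lemma rows_dependent_1:
  assumes n: "1 \<le> n" and C: "C \<subseteq> subsets_of_card n 1" and nz: "\<one> \<noteq> \<zero>"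
  shows "rows_dependent R n 1 C \<longleftrightarrow> C = subsets_of_card n 1"
  unfolding rows_dependent_iff[OF C]
proof
  assume "\<exists>c\<in>cocycles R n 1 C. \<exists>\<sigma>. c \<sigma> \<noteq> \<zero>"
  then obtain c \<sigma> where c: "c \<in> cocycles R n 1 C" "c \<sigma> \<noteq> \<zero>" by blast
  note cc = cocycles_carrier[OF c(1)]
  have eq: "c {i} = c {j}" if "i \<in> {1..n}" "j \<in> {1..n}" "i < j" for i j
  proof -
    have "coboundary R c {i, j} = \<zero>"
      using that by (intro cocycles_coboundary[OF c(1)]) (simp add: subsets_of_card_iff)
    then show ?thesis using coboundary_2[of i j c] that cc by simp
  qed
  have "\<sigma> \<in> subsets_of_card n 1" using cocycles_support[OF c] C by blast
  then obtain i where i: "i \<in> {1..n}" "\<sigma> = {i}" by (rule subsets_of_card_1E)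
  have "\<rho> \<in> C" if \<rho>: "\<rho> \<in> subsets_of_card n 1" for \<rho>
  proof -
    obtain j where j: "j \<in> {1..n}" "\<rho> = {j}" using \<rho> by (rule subsets_of_card_1E)
    have "c {j} = c {i}"
    proof (cases i j rule: linorder_cases)
      case less
      then show ?thesis using eq[OF i(1) j(1)] by simp
    next
      case greater
      then show ?thesis using eq[OF j(1) i(1)] by simp
    qed simp
    then have "c \<rho> \<noteq> \<zero>" using c(2) i(2) j(2) by simp
    with c(1) show ?thesis by (rule cocycles_support)
  qed
  then show "C = subsets_of_card n 1" using C by auto
next
  assume C: "C = subsets_of_card n 1"
  define c where "c \<sigma> = (if \<sigma> \<in> C then \<one> else \<zero>)" for \<sigma>
  have cc: "c \<sigma> \<in> carrier R" for \<sigma> by (simp add: c_def)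
  have "c \<in> cocycles R n 1 C"
  proof (rule cocyclesI)
    fix \<tau> assume "\<tau> \<in> subsets_of_card n (1 + 1)"
    then obtain i j where ij: "1 \<le> i" "i < j" "j \<le> n" "\<tau> = {i, j}"
      unfolding one_add_one by (rule subsets_of_card_2E)
    then have "{i} \<in> C" "{j} \<in> C" unfolding C by (auto simp: subsets_of_card_iff)
    then show "coboundary R c \<tau> = \<zero>" unfolding ij(4) coboundary_2[OF ij(2) cc] by (simp add: c_def)
  qed (auto simp: c_def split: if_splits)
  moreover have "c {1} \<noteq> \<zero>" using C n nz by (simp add: c_def subsets_of_card_iff)
  ultimately show "\<exists>c\<in>cocycles R n 1 C. \<exists>\<sigma>. c \<sigma> \<noteq> \<zero>" by blast
qed

text \<open>A cocycle is the coboundary of \<open>g j = c {1, j}\<close>, and every edge between the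
  zero set of \<open>g\<close> and its complement lies in the support. Conversely, the coboundary of
  the indicator function of \<open>S\<close> is supported on the edges of the cut.\<close>

lemma rows_dependent_2:
  assumes C: "C \<subseteq> subsets_of_card n 2" and nz: "\<one> \<noteq> \<zero>"
  shows "rows_dependent R n 2 C \<longleftrightarrow>
    (\<exists>S. {1..n} \<inter> S \<noteq> {} \<and> {1..n} - S \<noteq> {} \<and> (\<forall>i\<in>{1..n} \<inter> S. \<forall>j\<in>{1..n} - S. {i, j} \<in> C))"
    (is "_ \<longleftrightarrow> (\<exists>S. ?cut S)")
  unfolding rows_dependent_iff[OF C]
proof
  assume "\<exists>c\<in>cocycles R n 2 C. \<exists>\<sigma>. c \<sigma> \<noteq> \<zero>"
  then obtain c \<sigma> where c: "c \<in> cocycles R n 2 C" "c \<sigma> \<noteq> \<zero>" by blast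
  note cc = cocycles_carrier[OF c(1)]
  have less: "c {i, j} = c {1, j} \<ominus> c {1, i}" if "1 < i" "i < j" "j \<le> n" for i j
  proof -
    have "coboundary R c {1, i, j} = \<zero>"
      using that by (intro cocycles_coboundary[OF c(1)]) (simp add: subsets_of_card_iff)
    then have "c {i, j} \<ominus> c {1, j} \<oplus> c {1, i} = \<zero>" using coboundary_3[of 1 i j c] that cc by simp
    moreover have "c {i, j} = c {i, j} \<ominus> c {1, j} \<oplus> c {1, i} \<oplus> (c {1, j} \<ominus> c {1, i})"
      using cc[of "{i, j}"] cc[of "{1, j}"] cc[of "{1, i}"] by algebra
    ultimately show ?thesis using cc by simp
  qed
  have "\<sigma> \<in> subsets_of_card n 2" using cocycles_support[OF c] C by blast
  then obtain a b where ab: "1 \<le> a" "a < b" "b \<le> n" "\<sigma> = {a, b}" by (rule subsets_of_card_2E)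
  \<comment> \<open>For \<open>i = 1\<close> the set \<open>{1, i}\<close> collapses to
    \<open>{1}\<close>, which is no row index. So \<open>c {1, 1} = \<zero>\<close>, and
    \<open>less'\<close> covers the edges at vertex 1 too.\<close>
  have "{1} \<notin> C" using C by (auto simp: subsets_of_card_iff)
  then have c1: "c {1} = \<zero>" using cocycles_support[OF c(1)] by blast
  have less': "c {i, j} = c {1, j} \<ominus> c {1, i}" if "1 \<le> i" "i < j" "j \<le> n" for i j
    using less[of i j] that c1 cc by (cases "i = 1") (auto simp: a_minus_def)
  let ?S = "{j. c {1, j} = \<zero>}"
  have "?cut ?S"
  proof (intro conjI ballI)
    have "1 \<in> {1..n} \<inter> ?S" using c1 ab by simp
    then show "{1..n} \<inter> ?S \<noteq> {}" by blast
    have "c {1, a} \<noteq> \<zero> \<or> c {1, b} \<noteq> \<zero>" using c(2) ab less'[of a b] by auto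
    moreover have "a \<in> {1..n}" "b \<in> {1..n}" using ab by simp_all
    ultimately show "{1..n} - ?S \<noteq> {}" by blast
  next
    fix i j assume ij: "i \<in> {1..n} \<inter> ?S" "j \<in> {1..n} - ?S"
    have "c {i, j} \<noteq> \<zero>"
    proof (cases i j rule: linorder_cases)
      case less
      then show ?thesis using less'[of i j] ij cc by (auto simp: a_minus_def)
    next
      case greater
      then have "c {j, i} = \<ominus> c {1, j}" using less'[of j i] ij cc by (auto simp: a_minus_def)
      then show ?thesis using ij cc by (auto simp: insert_commute)
    qed (use ij in auto)
    with c(1) show "{i, j} \<in> C" by (rule cocycles_support)
  qed
  then show "\<exists>S. ?cut S" by (rule exI[of _ ?S])
next
  assume "\<exists>S. ?cut S"
  then obtain S where S: "?cut S" by (rule exE)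
  then obtain a b where ab: "a \<in> {1..n} \<inter> S" "b \<in> {1..n} - S" by (meson ex_in_conv)
  have cut: "{i, j} \<in> C" if "i \<in> {1..n}" "i \<in> S" "j \<in> {1..n}" "j \<notin> S" for i j
    using S that by (meson DiffI IntI)
  define \<delta> where "\<delta> i = (if i \<in> S then \<one> else \<zero>)" for i
  have \<delta>: "\<delta> i \<in> carrier R" for i by (simp add: \<delta>_def)
  \<comment> \<open>\<open>Max\<close> and \<open>Min\<close> orient an edge from its smaller to its
    larger end, which makes the difference a function of the set.\<close>
  define c where "c \<sigma> = (if \<sigma> \<in> subsets_of_card n 2 then \<delta> (Max \<sigma>) \<ominus> \<delta> (Min \<sigma>) else \<zero>)" for \<sigma>
  have cc: "c \<sigma> \<in> carrier R" for \<sigma> by (simp add: c_def \<delta>)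
  have c2: "c {i, j} = \<delta> j \<ominus> \<delta> i" if "1 \<le> i" "i < j" "j \<le> n" for i j
    using that by (simp add: c_def subsets_of_card_iff)
  have "c \<in> cocycles R n 2 C"
  proof (rule cocyclesI)
    fix \<sigma> assume nz: "c \<sigma> \<noteq> \<zero>"
    then have \<sigma>: "\<sigma> \<in> subsets_of_card n 2" by (auto simp: c_def split: if_splits)
    then obtain i j where ij: "1 \<le> i" "i < j" "j \<le> n" "\<sigma> = {i, j}" by (rule subsets_of_card_2E)
    then have "i \<in> {1..n}" "j \<in> {1..n}" by auto
    moreover have "\<delta> j \<noteq> \<delta> i" using nz c2[of i j] ij \<delta> by auto
    ultimately show "\<sigma> \<in> C"
      using cut[of i j] cut[of j i] ij(4) by (auto simp: \<delta>_def insert_commute split: if_splits)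
  next
    fix \<tau> assume "\<tau> \<in> subsets_of_card n (2 + 1)"
    then have "\<tau> \<in> subsets_of_card n 3" by simp
    then obtain i j k where ijk: "i < j" "j < k" "\<tau> = {i, j, k}" "1 \<le> i" "k \<le> n"
      by (rule subsets_of_card_3E)
    then have "coboundary R c \<tau> = (\<delta> k \<ominus> \<delta> j) \<ominus> (\<delta> k \<ominus> \<delta> i) \<oplus> (\<delta> j \<ominus> \<delta> i)"
      unfolding ijk(3) coboundary_3[OF ijk(1,2) cc] using ijk(1,2) by (simp add: c2)
    also have "\<dots> = \<zero>" using \<delta>[of i] \<delta>[of j] \<delta>[of k] by algebra
    finally show "coboundary R c \<tau> = \<zero>" .
  qed (simp add: cc)
  moreover have "c {a, b} \<noteq> \<zero>"
  proof (cases "a < b")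
    case True
    then show ?thesis using c2[of a b] ab nz by (simp add: \<delta>_def a_minus_def)
  next
    case False
    then have "b < a" using ab by (cases a b rule: linorder_cases) auto
    then show ?thesis using c2[of b a] ab nz by (simp add: \<delta>_def a_minus_def insert_commute)
  qed
  ultimately show "\<exists>c\<in>cocycles R n 2 C. \<exists>\<sigma>. c \<sigma> \<noteq> \<zero>" by blast
qed

text \<open>The only column is the full vertex set, and all its entries are signs. A single row is
  independent; two distinct index sets always admit a relation, even when their rows coincide as
  vectors.\<close>

lemma rows_dependent_corank_1:
  assumes n: "1 \<le> n" and C: "C \<subseteq> subsets_of_card n (n - 1)" and nz: "\<one> \<noteq> \<zero>"
  shows "rows_dependent R n (n - 1) C \<longleftrightarrow> (\<exists>\<sigma>\<in>C. \<exists>\<rho>\<in>C. \<sigma> \<noteq> \<rho>)"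
  unfolding rows_dependent_iff[OF C]
proof
  let ?V = "{1..n}"
  have mem: "\<exists>i\<in>?V. \<sigma> = ?V - {i}" if "\<sigma> \<in> C" for \<sigma>
    using that C subsets_of_card_pred[OF n] by blast
  have col: "subsets_of_card n (n - 1 + 1) = {?V}"
  proof -
    have "\<tau> = ?V" if "\<tau> \<subseteq> ?V" "card \<tau> = n" for \<tau>
      using that by (intro card_subset_eq) auto
    moreover have "n - 1 + 1 = n" using n by simp
    ultimately show ?thesis unfolding subsets_of_card_def by auto
  qed
  define s where "s i = sgn_pow (card {s \<in> ?V. s < i})" for i
  have s: "s i \<in> carrier R" for i by (simp add: s_def)
  have s_iff: "s i \<otimes> x = y \<longleftrightarrow> x = s i \<otimes> y" if "x \<in> carrier R" "y \<in> carrier R" for i x y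
    using that unfolding s_def by (rule sgn_pow_mult_eq)
  have cob: "coboundary R c ?V = (\<Oplus>i\<in>?V. s i \<otimes> c (?V - {i}))" for c
    by (simp add: coboundary_def s_def)
  {
    assume "\<exists>c\<in>cocycles R n (n - 1) C. \<exists>\<sigma>. c \<sigma> \<noteq> \<zero>"
    then obtain c \<sigma> where c: "c \<in> cocycles R n (n - 1) C" "c \<sigma> \<noteq> \<zero>" by blast
    have \<sigma>: "\<sigma> \<in> C" using c by (rule cocycles_support)
    then obtain i where i: "i \<in> ?V" "\<sigma> = ?V - {i}" using mem by blast
    show "\<exists>\<sigma>\<in>C. \<exists>\<rho>\<in>C. \<sigma> \<noteq> \<rho>"
    proof (rule ccontr)
      assume "\<not> ?thesis"
      then have *: "\<rho> = \<sigma>" if "c \<rho> \<noteq> \<zero>" for \<rho> using \<sigma> cocycles_support[OF c(1) that] by blast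
      have "c (?V - {j}) = \<zero>" if "j \<in> ?V" "j \<noteq> i" for j using *[of "?V - {j}"] that i by blast
      then have "coboundary R c ?V = s i \<otimes> c \<sigma>"
        unfolding cob i(2) by (intro finsum_single) (use i s cocycles_carrier[OF c(1)] in auto)
      moreover have "coboundary R c ?V = \<zero>" using cocycles_coboundary[OF c(1)] col by blast
      ultimately show False using c(2) s_iff cocycles_carrier[OF c(1)] s by auto
    qed
  }
  assume "\<exists>\<sigma>\<in>C. \<exists>\<rho>\<in>C. \<sigma> \<noteq> \<rho>"
  then obtain \<sigma> \<rho> where \<sigma>\<rho>: "\<sigma> \<in> C" "\<rho> \<in> C" "\<sigma> \<noteq> \<rho>" by blast
  then obtain i j where ij: "i \<in> ?V" "\<sigma> = ?V - {i}" "j \<in> ?V" "\<rho> = ?V - {j}" using mem by meson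
  then have "i \<noteq> j" using \<sigma>\<rho> by auto
  \<comment> \<open>Up to the minus at \<open>\<rho>\<close>, each coefficient repeats the sign of
    its own entry, so the two products are 1 and -1.\<close>
  define c where "c \<tau> = (if \<tau> = \<sigma> then s i else if \<tau> = \<rho> then \<ominus> s j else \<zero>)" for \<tau>
  have cc: "c \<tau> \<in> carrier R" for \<tau> using s by (simp add: c_def)
  have "s i \<otimes> s i = \<one>" for i using s_iff[of "s i" \<one> i] s by simp
  moreover have "s i \<noteq> \<zero>" using s_iff[of \<one> \<zero> i] nz s by auto
  moreover have "coboundary R c ?V = s i \<otimes> c \<sigma> \<oplus> s j \<otimes> c \<rho>"
    unfolding cob ij(2,4)
  proof (rule finsum_pair)
    fix x assume x: "x \<in> ?V" "x \<noteq> i" "x \<noteq> j"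
    then have "?V - {x} \<noteq> ?V - {i}" "?V - {x} \<noteq> ?V - {j}" by blast+
    then show "s x \<otimes> c (?V - {x}) = \<zero>" using s by (simp add: c_def ij(2,4))
  qed (use ij(1,3) s cc \<open>i \<noteq> j\<close> in simp_all)
  moreover have "c \<sigma> = s i" "c \<rho> = \<ominus> s j" using \<sigma>\<rho>(3) by (simp_all add: c_def)
  ultimately have "coboundary R c ?V = \<zero>" "c \<sigma> \<noteq> \<zero>"
    using s by (simp_all add: r_minus r_neg)
  then have "c \<in> cocycles R n (n - 1) C"
    using cc col \<sigma>\<rho> by (intro cocyclesI) (auto simp: c_def split: if_splits)
  then show "\<exists>c\<in>cocycles R n (n - 1) C. \<exists>\<sigma>. c \<sigma> \<noteq> \<zero>" using \<open>c \<sigma> \<noteq> \<zero>\<close> by blast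
qed

end

subsection \<open>Flows on graphs and the case $p = n - 2$\<close>

text \<open>\<open>\<phi> a z\<close> is the amount sent from \<open>a\<close> to \<open>z\<close>,
  so summing over \<open>a\<close> gives the net inflow at \<open>z\<close>. Conservation is left
  out because flows with a source and a sink occur on the way to circulations. The zero diagonal is
  a clause of its own since antisymmetry does not give it in characteristic 2.\<close>

definition flows :: "('a, 'm) ring_scheme \<Rightarrow> nat set \<Rightarrow> nat set set \<Rightarrow> (nat \<Rightarrow> nat \<Rightarrow> 'a) set" where
  "flows K V E =
     {\<phi>. (\<forall>u v. \<phi> u v \<in> carrier K) \<and> (\<forall>u v. \<phi> u v = \<ominus>\<^bsub>K\<^esub> \<phi> v u) \<and> (\<forall>u. \<phi> u u = \<zero>\<^bsub>K\<^esub>) \<and>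
         (\<forall>u v. \<phi> u v \<noteq> \<zero>\<^bsub>K\<^esub> \<longrightarrow> u \<in> V \<and> v \<in> V \<and> {u, v} \<in> E)}"

text \<open>For an edge \<open>{u, v}\<close>, such a set \<open>S\<close> certifies a bridge: once
  the edge is deleted, \<open>u\<close> and \<open>v\<close> lie in different components.\<close>

definition edge_cut :: "nat set set \<Rightarrow> nat \<Rightarrow> nat \<Rightarrow> nat set \<Rightarrow> bool" where
  "edge_cut E u v S \<longleftrightarrow> u \<in> S \<and> v \<notin> S \<and> (\<forall>x\<in>S. \<forall>y\<in>-S. {x, y} \<in> E \<longrightarrow> {x, y} = {u, v})"

lemma flowsI:
  assumes "\<And>u v. \<phi> u v \<in> carrier K" "\<And>u v. \<phi> u v = \<ominus>\<^bsub>K\<^esub> \<phi> v u" "\<And>u. \<phi> u u = \<zero>\<^bsub>K\<^esub>"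
    "\<And>u v. \<phi> u v \<noteq> \<zero>\<^bsub>K\<^esub> \<Longrightarrow> u \<in> V \<and> v \<in> V \<and> {u, v} \<in> E"
  shows "\<phi> \<in> flows K V E"
  unfolding flows_def
  by (intro CollectI conjI allI impI, rule assms(1), rule assms(2), rule assms(3), auto dest: assms(4))

lemma flowsD:
  assumes "\<phi> \<in> flows K V E"
  shows flows_carrier: "\<phi> u v \<in> carrier K"
    and flows_antisym: "\<phi> u v = \<ominus>\<^bsub>K\<^esub> \<phi> v u"
    and flows_diag: "\<phi> u u = \<zero>\<^bsub>K\<^esub>"
    and flows_support: "\<phi> u v \<noteq> \<zero>\<^bsub>K\<^esub> \<Longrightarrow> u \<in> V \<and> v \<in> V \<and> {u, v} \<in> E"
  using assms unfolding flows_def by blast+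

context cring
begin

definition edge_flow :: "nat \<Rightarrow> nat \<Rightarrow> nat \<Rightarrow> nat \<Rightarrow> 'a" where
  "edge_flow x y a b = (if a = x \<and> b = y then \<one> else if a = y \<and> b = x then \<ominus> \<one> else \<zero>)"

lemma edge_flow_flows:
  assumes "x \<in> V" "y \<in> V" "x \<noteq> y" "{x, y} \<in> E"
  shows "edge_flow x y \<in> flows R V E"
  by (rule flowsI) (use assms in \<open>auto simp: edge_flow_def insert_commute split: if_splits\<close>)

lemma div_edge_flow:
  assumes "finite V" "x \<in> V" "y \<in> V" "x \<noteq> y"
  shows "(\<Oplus>a\<in>V. edge_flow x y a z) = (if z = y then \<one> else \<zero>) \<ominus> (if z = x then \<one> else \<zero>)"
proof -
  have "(\<Oplus>a\<in>V. edge_flow x y a z) = edge_flow x y x z \<oplus> edge_flow x y y z"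
    by (rule finsum_pair) (use assms in \<open>auto simp: edge_flow_def\<close>)
  then show ?thesis using assms by (auto simp: edge_flow_def a_minus_def)
qed

lemma flows_add:
  assumes "\<phi> \<in> flows R V E" "\<psi> \<in> flows R V E"
  shows "(\<lambda>u v. \<phi> u v \<oplus> \<psi> u v) \<in> flows R V E"
proof (rule flowsI)
  note c = assms[THEN flows_carrier]
  show "\<phi> u v \<oplus> \<psi> u v \<in> carrier R" for u v using c by simp
  show "\<phi> u v \<oplus> \<psi> u v = \<ominus> (\<phi> v u \<oplus> \<psi> v u)" for u v
    unfolding flows_antisym[OF assms(1), of u v] flows_antisym[OF assms(2), of u v]
    using c by (simp add: minus_add)
  show "\<phi> u u \<oplus> \<psi> u u = \<zero>" for u using assms[THEN flows_diag] by simp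
  show "u \<in> V \<and> v \<in> V \<and> {u, v} \<in> E" if "\<phi> u v \<oplus> \<psi> u v \<noteq> \<zero>" for u v
  proof -
    have "\<phi> u v \<noteq> \<zero> \<or> \<psi> u v \<noteq> \<zero>" using that by auto
    then show ?thesis using assms[THEN flows_support] by blast
  qed
qed

lemma div_flows_add:
  assumes "\<phi> \<in> flows R V E" "\<psi> \<in> flows R V E"
  shows "(\<Oplus>a\<in>V. \<phi> a z \<oplus> \<psi> a z) = (\<Oplus>a\<in>V. \<phi> a z) \<oplus> (\<Oplus>a\<in>V. \<psi> a z)"
  by (rule finsum_addf) (auto intro: assms[THEN flows_carrier])

text \<open>An edge that is not a bridge lies on a cycle. In place of a path, a unit flow from
  \<open>u\<close> to \<open>v\<close> avoiding the edge is built and then closed up along the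
  edge.\<close>

lemma ex_circulation_if_no_edge_cut:
  assumes V: "finite V" "u \<in> V" "v \<in> V" and uv: "u \<noteq> v" "{u, v} \<in> E" and EV: "\<Union>E \<subseteq> V"
    and no_cut: "\<And>S. \<not> edge_cut E u v S" and nz: "\<one> \<noteq> \<zero>"
  shows "\<exists>\<phi>\<in>flows R V E. (\<exists>u v. \<phi> u v \<noteq> \<zero>) \<and> (\<forall>z\<in>V. (\<Oplus>a\<in>V. \<phi> a z) = \<zero>)"
proof -
  let ?E = "E - {{u, v}}"
  define \<delta> :: "nat \<Rightarrow> nat \<Rightarrow> 'a" where "\<delta> x z = (if z = x then \<one> else \<zero>)" for x z
  have \<delta>: "\<delta> x z \<in> carrier R" for x z by (simp add: \<delta>_def)
  have tel: "(\<delta> x z \<ominus> \<delta> y z) \<oplus> (\<delta> w z \<ominus> \<delta> x z) = \<delta> w z \<ominus> \<delta> y z" for x y z w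
    using \<delta>[of x z] \<delta>[of y z] \<delta>[of w z] by algebra
  \<comment> \<open>The vertices to which one unit can be sent from \<open>u\<close> without using
    the edge \<open>{u, v}\<close>. The set is closed under all other edges, since adding
    \<open>edge_flow x y\<close> to a flow ending at \<open>x\<close> gives one ending at
    \<open>y\<close>.\<close>
  define S where "S = {w \<in> V. \<exists>\<phi>\<in>flows R V ?E. \<forall>z\<in>V. (\<Oplus>a\<in>V. \<phi> a z) = \<delta> w z \<ominus> \<delta> u z}"
  have "(\<lambda>_ _. \<zero>) \<in> flows R V ?E" by (rule flowsI) auto
  moreover have "\<delta> u z \<ominus> \<delta> u z = \<zero>" for z using \<delta>[of u z] by algebra
  ultimately have uS: "u \<in> S" unfolding S_def using V by (auto intro!: bexI[of _ "\<lambda>_ _. \<zero>"])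
  have "y \<in> S" if x: "x \<in> S" and y: "{x, y} \<in> E" "{x, y} \<noteq> {u, v}" for x y
  proof (cases "x = y")
    case False
    obtain \<phi> where \<phi>: "\<phi> \<in> flows R V ?E" "\<And>z. z \<in> V \<Longrightarrow> (\<Oplus>a\<in>V. \<phi> a z) = \<delta> x z \<ominus> \<delta> u z"
      using x unfolding S_def by blast
    have xV: "x \<in> V" "y \<in> V" using x y EV by (auto simp: S_def)
    have e: "edge_flow x y \<in> flows R V ?E"
      using xV False y by (intro edge_flow_flows) auto
    have "(\<Oplus>a\<in>V. \<phi> a z \<oplus> edge_flow x y a z) = \<delta> y z \<ominus> \<delta> u z" if "z \<in> V" for z
      using div_flows_add[OF \<phi>(1) e] \<phi>(2)[OF that] div_edge_flow[OF V(1) xV False] tel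
      by (simp add: \<delta>_def)
    then show ?thesis
      unfolding S_def using flows_add[OF \<phi>(1) e] xV
      by (intro CollectI conjI bexI[of _ "\<lambda>a b. \<phi> a b \<oplus> edge_flow x y a b"]) simp_all
  qed (use x in simp)
  \<comment> \<open>If \<open>v\<close> were missing, \<open>S\<close> would be an edge cut.\<close>
  then have "v \<in> S" using no_cut[of S] uS unfolding edge_cut_def by blast
  then obtain \<phi> where \<phi>: "\<phi> \<in> flows R V ?E" "\<And>z. z \<in> V \<Longrightarrow> (\<Oplus>a\<in>V. \<phi> a z) = \<delta> v z \<ominus> \<delta> u z"
    unfolding S_def by blast
  have \<phi>E: "\<phi> \<in> flows R V E" using \<phi>(1) unfolding flows_def by blast
  have e: "edge_flow v u \<in> flows R V E"
    using V uv by (intro edge_flow_flows) (auto simp: insert_commute)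
  \<comment> \<open>\<open>\<phi>\<close> avoids the edge, so the returning unit is not cancelled on
    it and the closed-up flow is nonzero.\<close>
  have "\<phi> v u = \<zero>"
  proof (rule ccontr)
    assume "\<phi> v u \<noteq> \<zero>"
    then have "{v, u} \<in> ?E" using flows_support[OF \<phi>(1)] by blast
    then show False by (simp add: insert_commute)
  qed
  then have "\<phi> v u \<oplus> edge_flow v u v u \<noteq> \<zero>" using nz by (simp add: edge_flow_def)
  moreover have "(\<Oplus>a\<in>V. \<phi> a z \<oplus> edge_flow v u a z) = \<zero>" if "z \<in> V" for z
  proof -
    have "\<delta> v z \<ominus> \<delta> u z \<oplus> (\<delta> u z \<ominus> \<delta> v z) = \<zero>"
      using \<delta>[of u z] \<delta>[of v z] by algebra
    then show ?thesis
      using div_flows_add[OF \<phi>E e] \<phi>(2)[OF that] div_edge_flow[OF V(1) V(3,2)] uv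
      by (simp add: \<delta>_def)
  qed
  ultimately show ?thesis
    by (intro bexI[OF _ flows_add[OF \<phi>E e]] conjI exI[of _ v] exI[of _ u] ballI)
qed

text \<open>Add up the net inflow over the vertices in \<open>S\<close>. Flow inside
  \<open>S\<close> cancels by antisymmetry, and only \<open>{u, v}\<close> can carry flow across the
  cut, so the total is \<open>\<phi> v u\<close>.\<close>

lemma circulation_zero_if_edge_cut:
  assumes V: "finite V" and \<phi>: "\<phi> \<in> flows R V E" "\<And>z. z \<in> V \<Longrightarrow> (\<Oplus>a\<in>V. \<phi> a z) = \<zero>"
    and S: "edge_cut E u v S"
  shows "\<phi> u v = \<zero>"
proof (rule ccontr)
  assume nz: "\<phi> u v \<noteq> \<zero>"
  have f: "\<phi> x y \<in> carrier R" "\<phi> x x = \<zero>" "\<phi> x y \<noteq> \<zero> \<Longrightarrow> x \<in> V \<and> y \<in> V \<and> {x, y} \<in> E" for x y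
    using flowsD[OF \<phi>(1)] by blast+
  have anti: "\<phi> x y = \<ominus> \<phi> y x" for x y using \<phi>(1) by (rule flows_antisym)
  have "\<phi> v u \<noteq> \<zero>"
  proof
    assume "\<phi> v u = \<zero>"
    then show False using nz by (subst (asm) anti) simp
  qed
  then have uv: "u \<in> V" "v \<in> V" "u \<in> S" "v \<notin> S" "\<phi> v u \<noteq> \<zero>"
    using f(3)[OF nz] S by (auto simp: edge_cut_def)
  have crossing: "\<phi> y x = \<zero>" if "x \<in> S" "y \<notin> S" "x \<noteq> u \<or> y \<noteq> v" for x y
  proof (rule ccontr)
    assume "\<phi> y x \<noteq> \<zero>"
    then have "{x, y} \<in> E" using f(3)[of y x] by (simp add: insert_commute)
    then have "{x, y} = {u, v}" using that S by (auto simp: edge_cut_def)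
    then show False using that uv by (auto simp: doubleton_eq_iff)
  qed
  have "\<zero> = (\<Oplus>x\<in>V \<inter> S. \<Oplus>y\<in>V. \<phi> y x)"
    by (rule add.finprod_one_eqI[symmetric]) (simp add: \<phi>(2))
  also have "\<dots> = (\<Oplus>x\<in>V \<inter> S. (\<Oplus>y\<in>V \<inter> S. \<phi> y x) \<oplus> (\<Oplus>y\<in>V - S. \<phi> y x))"
  proof (rule finsum_cong')
    fix x
    have "V \<inter> S \<union> (V - S) = V" by auto
    then show "(\<Oplus>y\<in>V. \<phi> y x) = (\<Oplus>y\<in>V \<inter> S. \<phi> y x) \<oplus> (\<Oplus>y\<in>V - S. \<phi> y x)"
      using V f finsum_Un_disjoint[of "V \<inter> S" "V - S" "\<lambda>y. \<phi> y x"] by (auto simp: Pi_def)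
  qed (use f in auto)
  also have "\<dots> = (\<Oplus>x\<in>V \<inter> S. \<Oplus>y\<in>V \<inter> S. \<phi> y x) \<oplus> (\<Oplus>x\<in>V \<inter> S. \<Oplus>y\<in>V - S. \<phi> y x)"
    by (rule finsum_addf) (use f in auto)
  also have "(\<Oplus>x\<in>V \<inter> S. \<Oplus>y\<in>V \<inter> S. \<phi> y x) = \<zero>"
    by (rule finsum_alternating) (use V in simp, rule f, rule anti, rule f)
  also have "(\<Oplus>x\<in>V \<inter> S. \<Oplus>y\<in>V - S. \<phi> y x) = (\<Oplus>y\<in>V - S. \<phi> y u)"
    by (rule finsum_single) (use V uv f crossing in \<open>auto intro: add.finprod_one_eqI\<close>)
  also have "\<dots> = \<phi> v u"
    by (rule finsum_single) (use V uv f crossing in auto)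
  finally show False using uv f by auto
qed

lemma ex_circulation_iff:
  assumes V: "finite V" and E: "\<Union>E \<subseteq> V" and nz: "\<one> \<noteq> \<zero>"
  shows "(\<exists>\<phi>\<in>flows R V E. (\<exists>u v. \<phi> u v \<noteq> \<zero>) \<and> (\<forall>z\<in>V. (\<Oplus>a\<in>V. \<phi> a z) = \<zero>)) \<longleftrightarrow>
    (\<exists>u v. u \<noteq> v \<and> {u, v} \<in> E \<and> (\<forall>S. \<not> edge_cut E u v S))" (is "?L \<longleftrightarrow> ?R")
proof
  assume ?L
  then obtain \<phi> u v where \<phi>: "\<phi> \<in> flows R V E" "\<And>z. z \<in> V \<Longrightarrow> (\<Oplus>a\<in>V. \<phi> a z) = \<zero>" "\<phi> u v \<noteq> \<zero>"
    by blast
  then have "u \<noteq> v" "{u, v} \<in> E" using flows_diag flows_support by metis+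
  then show ?R using circulation_zero_if_edge_cut[OF V \<phi>(1,2)] \<phi>(3) by blast
next
  assume ?R
  then obtain u v where uv: "u \<noteq> v" "{u, v} \<in> E" "\<And>S. \<not> edge_cut E u v S" by blast
  then have "u \<in> V" "v \<in> V" using E by auto
  then show ?L using ex_circulation_if_no_edge_cut[OF V _ _ uv(1,2) E uv(3) nz] by blast
qed

end

section \<open>Complements of rows as edges of a graph\<close>

text \<open>The two counts are \<open>u - 1\<close> and \<open>v - 2\<close>. The \<open>Suc\<close>
  becomes the factor -1 that makes the signs of the next proof antisymmetric.\<close>

lemma card_below_add_parity:
  fixes n u v :: nat
  assumes "u \<in> {1..n}" "v \<in> {1..n}" "u < v"
  shows "v + card {s \<in> {1..n} - {v}. s < u} = Suc (u + card {s \<in> {1..n} - {u}. s < v})"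
proof -
  have "{s \<in> {1..n} - {v}. s < u} = {1..<u}" "{s \<in> {1..n} - {u}. s < v} = {1..<v} - {u}"
    using assms by auto
  then show ?thesis using assms by simp
qed

text \<open>Rows are complements of edges, columns are complements of single vertices.
  Multiplication by the signs \<open>s u v\<close> turns a cochain into an antisymmetric function,
  and the column missing \<open>v\<close> becomes conservation at \<open>v\<close>.\<close>

lemma (in field) rows_dependent_corank_2:
  assumes n: "2 \<le> n" and C: "C \<subseteq> subsets_of_card n (n - 2)"
  defines "E \<equiv> (\<lambda>\<sigma>. {1..n} - \<sigma>) ` C"
  shows "rows_dependent R n (n - 2) C \<longleftrightarrow>
    (\<exists>u v. u \<noteq> v \<and> {u, v} \<in> E \<and> (\<forall>S. \<not> edge_cut E u v S))"
proof -
  let ?V = "{1..n}"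
  \<comment> \<open>Without \<open>v\<close> in the exponent this is the matrix entry of row
    \<open>?V - {u, v}\<close> in column \<open>?V - {v}\<close>. The extra sign is constant along a
    column, so it preserves the equations, and it makes \<open>s\<close> antisymmetric.\<close>
  define s where "s u v = sgn_pow (v + card {s \<in> ?V - {v}. s < u})" for u v
  have s: "s u v \<in> carrier R" "s u v \<otimes> s u v = \<one>" for u v
  proof -
    show "s u v \<in> carrier R" by (simp add: s_def)
    then show "s u v \<otimes> s u v = \<one>" unfolding s_def by (subst sgn_pow_mult_eq) auto
  qed
  have s_anti: "s u v = \<ominus> s v u" if uv: "u \<in> ?V" "v \<in> ?V" "u \<noteq> v" for u v
  proof (cases "u < v")
    case True
    show ?thesis
      unfolding s_def card_below_add_parity[OF uv(1,2) True] by (simp add: r_minus)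
  next
    case False
    then have "v < u" using uv by simp
    then show ?thesis
      unfolding s_def card_below_add_parity[OF uv(2,1) \<open>v < u\<close>] by (simp add: r_minus)
  qed
  have memE: "{u, v} \<in> E \<longleftrightarrow> ?V - {u, v} \<in> C" if "u \<in> ?V" "v \<in> ?V" for u v
  proof -
    have "?V - (?V - {u, v}) = {u, v}" using that by auto
    moreover have "\<sigma> = ?V - (?V - \<sigma>)" if "\<sigma> \<in> C" for \<sigma>
      using that C by (auto simp: subsets_of_card_def)
    ultimately show ?thesis unfolding E_def by (metis (no_types, lifting) image_iff)
  qed
  have cols: "subsets_of_card n (n - 2 + 1) = (\<lambda>v. ?V - {v}) ` ?V"
  proof -
    have "n - 2 + 1 = n - 1" using n by simp
    then show ?thesis using subsets_of_card_pred[of n] n by (simp only:)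
  qed
  \<comment> \<open>Stated for any matching pair, because it serves the passage from
    \<open>c\<close> to \<open>\<phi>\<close> as well as the way back.\<close>
  have div_eq: "(\<Oplus>u\<in>?V. \<phi> u v) = sgn_pow v \<otimes> coboundary R c (?V - {v})"
    if v: "v \<in> ?V" and c: "\<And>\<sigma>. c \<sigma> \<in> carrier R" and \<phi>v: "\<phi> v v = \<zero>"
      and \<phi>: "\<And>u. u \<in> ?V \<Longrightarrow> u \<noteq> v \<Longrightarrow> \<phi> u v = s u v \<otimes> c (?V - {u, v})" for v c \<phi>
  proof -
    have "(\<Oplus>u\<in>?V. \<phi> u v) = (\<Oplus>u\<in>?V - {v}. \<phi> u v)"
      by (rule finsum_support) (use \<phi> \<phi>v c s in auto)
    also have "\<dots> = (\<Oplus>u\<in>?V - {v}. sgn_pow v \<otimes> (sgn_pow (card {s \<in> ?V - {v}. s < u}) \<otimes> c (?V - {v} - {u})))"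
    proof (rule finsum_cong')
      fix u assume "u \<in> ?V - {v}"
      moreover have "?V - {v} - {u} = ?V - {u, v}" by auto
      ultimately show "\<phi> u v = sgn_pow v \<otimes> (sgn_pow (card {s \<in> ?V - {v}. s < u}) \<otimes> c (?V - {v} - {u}))"
        using \<phi>[of u] c by (simp add: s_def nat_pow_mult[symmetric] m_assoc)
    qed (use c in auto)
    also have "\<dots> = sgn_pow v \<otimes> coboundary R c (?V - {v})"
      unfolding coboundary_def by (rule finsum_rdistr[symmetric]) (use c in auto)
    finally show ?thesis .
  qed
  have z_iff: "sgn_pow v \<otimes> x = \<zero> \<longleftrightarrow> x = \<zero>" if "x \<in> carrier R" for v x
    using that by (simp add: sgn_pow_mult_eq)
  have cb: "coboundary R c \<tau> \<in> carrier R" if "\<And>\<sigma>. c \<sigma> \<in> carrier R" for c \<tau>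
    unfolding coboundary_def using that by auto
  have "(\<exists>c\<in>cocycles R n (n - 2) C. \<exists>\<sigma>. c \<sigma> \<noteq> \<zero>) \<longleftrightarrow>
    (\<exists>\<phi>\<in>flows R ?V E. (\<exists>u v. \<phi> u v \<noteq> \<zero>) \<and> (\<forall>z\<in>?V. (\<Oplus>a\<in>?V. \<phi> a z) = \<zero>))" (is "?L \<longleftrightarrow> ?R")
  proof
    assume ?L
    then obtain c \<sigma> where cC: "c \<in> cocycles R n (n - 2) C" and "c \<sigma> \<noteq> \<zero>" by blast
    then have c: "\<And>\<sigma>. c \<sigma> \<in> carrier R" "\<And>\<sigma>. \<sigma> \<notin> C \<Longrightarrow> c \<sigma> = \<zero>"
      "\<And>v. v \<in> ?V \<Longrightarrow> coboundary R c (?V - {v}) = \<zero>" "c \<sigma> \<noteq> \<zero>"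
      unfolding cocycles_def cols by simp_all
    define \<phi> where "\<phi> u v = (if u \<in> ?V \<and> v \<in> ?V \<and> u \<noteq> v then s u v \<otimes> c (?V - {u, v}) else \<zero>)" for u v
    have "\<phi> \<in> flows R ?V E"
    proof -
      have "\<phi> u v \<in> carrier R" for u v using c s by (simp add: \<phi>_def)
      moreover have "\<phi> u v = \<ominus> \<phi> v u" for u v
        using c s s_anti[of u v] by (auto simp: \<phi>_def l_minus insert_commute)
      moreover have "{u, v} \<in> E" if "\<phi> u v \<noteq> \<zero>" for u v
        using that c(2)[of "?V - {u, v}"] s memE[of u v] by (auto simp: \<phi>_def split: if_splits)
      moreover have "u \<in> ?V \<and> v \<in> ?V" if "\<phi> u v \<noteq> \<zero>" for u v
        using that by (auto simp: \<phi>_def split: if_splits)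
      moreover have "\<phi> u u = \<zero>" for u by (simp add: \<phi>_def)
      ultimately show ?thesis by (intro flowsI) blast+
    qed
    moreover have "(\<Oplus>a\<in>?V. \<phi> a v) = \<zero>" if v: "v \<in> ?V" for v
      by (subst div_eq[where c = c]) (use v c in \<open>auto simp: \<phi>_def\<close>)
    moreover have "\<exists>u v. \<phi> u v \<noteq> \<zero>"
    proof -
      have \<sigma>: "\<sigma> \<in> C" using c by blast
      then have "card (?V - \<sigma>) = 2"
        using C n by (subst card_Diff_subset) (auto simp: subsets_of_card_def intro: finite_subset)
      then obtain u v where uv: "u \<noteq> v" "?V - \<sigma> = {u, v}" by (meson card_2_iff)
      moreover have "\<sigma> \<subseteq> ?V" using \<sigma> C by (auto simp: subsets_of_card_def)
      ultimately have "?V - {u, v} = \<sigma>" "u \<in> ?V" "v \<in> ?V" by auto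
      then have "\<phi> u v \<noteq> \<zero>" using uv c z_iff[OF c(1)] by (simp add: \<phi>_def s_def)
      then show ?thesis by blast
    qed
    ultimately show ?R by blast
  next
    assume ?R
    then obtain \<phi> a b where \<phi>: "\<phi> \<in> flows R ?V E" "\<phi> a b \<noteq> \<zero>" "\<And>z. z \<in> ?V \<Longrightarrow> (\<Oplus>a\<in>?V. \<phi> a z) = \<zero>"
      by blast
    have f: "\<phi> x y \<in> carrier R" "\<phi> x x = \<zero>" "\<phi> x y \<noteq> \<zero> \<Longrightarrow> x \<in> ?V \<and> y \<in> ?V \<and> {x, y} \<in> E" for x y
      using flowsD[OF \<phi>(1)] by blast+
    have anti: "\<phi> x y = \<ominus> \<phi> y x" for x y using \<phi>(1) by (rule flows_antisym)
    \<comment> \<open>A cochain depends on a set, so the two missing vertices are put in increasing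
      order. Since \<open>s u v\<close> is its own inverse, this undoes the passage from
      \<open>c\<close> to \<open>\<phi>\<close>.\<close>
    define c where "c \<sigma> = (if \<sigma> \<in> C then let u = Min (?V - \<sigma>); v = Max (?V - \<sigma>) in s u v \<otimes> \<phi> u v else \<zero>)" for \<sigma>
    have c: "c \<sigma> \<in> carrier R" for \<sigma> using f s by (simp add: c_def Let_def)
    have less: "\<phi> u v = s u v \<otimes> c (?V - {u, v})" if uv: "u \<in> ?V" "v \<in> ?V" "u < v" for u v
    proof (cases "?V - {u, v} \<in> C")
      case True
      have "?V - (?V - {u, v}) = {u, v}" using uv by auto
      moreover have "Min {u, v} = u" "Max {u, v} = v" using uv by auto
      ultimately have "c (?V - {u, v}) = s u v \<otimes> \<phi> u v"
        unfolding c_def using True by (simp only: if_True Let_def)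
      then show ?thesis using s[of u v] f(1)[of u v] by (simp add: m_assoc[symmetric])
    next
      case False
      then have "\<phi> u v = \<zero>" using f(3)[of u v] memE uv by blast
      then show ?thesis using False s by (simp add: c_def)
    qed
    have eq: "\<phi> u v = s u v \<otimes> c (?V - {u, v})" if uv: "u \<in> ?V" "v \<in> ?V" "u \<noteq> v" for u v
    proof (cases "u < v")
      case False
      then have "\<phi> v u = s v u \<otimes> c (?V - {v, u})" using less uv by simp
      then show ?thesis
        using anti[of u v] s_anti[OF uv] s c by (simp add: l_minus insert_commute)
    qed (use less uv in simp)
    have "coboundary R c (?V - {v}) = \<zero>" if v: "v \<in> ?V" for v
      using div_eq[where c = c and \<phi> = \<phi>, OF v] c f(2) eq v \<phi>(3)[OF v] z_iff[OF cb[of c]] by simp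
    then have "c \<in> cocycles R n (n - 2) C"
      unfolding cocycles_def cols using c by (auto simp: c_def)
    moreover have "c (?V - {a, b}) \<noteq> \<zero>"
    proof -
      have "a \<in> ?V" "b \<in> ?V" "a \<noteq> b" using f(3)[of a b] \<phi>(2) f(2)[of a] by auto
      then have "\<phi> a b = s a b \<otimes> c (?V - {a, b})" by (rule eq)
      then show ?thesis using \<phi>(2) s by auto
    qed
    ultimately show ?L by blast
  qed
  also have "?R \<longleftrightarrow> (\<exists>u v. u \<noteq> v \<and> {u, v} \<in> E \<and> (\<forall>S. \<not> edge_cut E u v S))"
    by (rule ex_circulation_iff) (auto simp: E_def)
  finally show ?thesis using rows_dependent_iff[OF C] by simp
qed


subsection \<open>The six-vertex projective plane\<close>

text \<open>
  The ten triangles are the triples of vertex 1 with an edge of the 5-cycle 2, 3, 4, 5, 6, and the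
  five triples of \<open>rp2_count_even\<close>. The edges listed below are the chords of the 5-cycle.
\<close>

definition rp2_edges :: "(nat \<times> nat) set" where
  "rp2_edges = {(2, 4), (2, 5), (3, 5), (3, 6), (4, 6)}"

text \<open>On triples its parity is the coboundary modulo 2 of the edge labelling that is 1 on the
  chords.\<close>

definition rp2_count :: "nat set \<Rightarrow> nat" where
  "rp2_count \<sigma> = (\<Sum>(a, b)\<in>rp2_edges. of_bool (a \<in> \<sigma> \<and> b \<in> \<sigma>))"

definition rp2_triples :: "nat \<Rightarrow> nat set set" where
  "rp2_triples m = {\<sigma> \<in> subsets_of_card m 3. odd (rp2_count \<sigma>)}"

lemma finite_rp2_edges: "finite rp2_edges"
  by (simp add: rp2_edges_def)

text \<open>Vertex 1 lies on no chord, so only the edge from \<open>j\<close> to \<open>k\<close>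
  can count; \<open>j < k\<close> fits the ordering of the pairs in
  \<open>rp2_edges\<close>.\<close>

lemma rp2_count_cone:
  assumes "1 < j" "j < k"
  shows "rp2_count {1, j, k} = of_bool ((j, k) \<in> rp2_edges)"
proof -
  have "rp2_count {1, j, k} = (\<Sum>e\<in>rp2_edges. if e = (j, k) then 1 else 0)"
    unfolding rp2_count_def using assms
    by (intro sum.cong) (auto simp: rp2_edges_def)
  then show ?thesis by (simp add: finite_rp2_edges)
qed

text \<open>Each triangle has one side on the 5-cycle and two chords as its other sides. Together
  they form the Moebius band that remains after deleting the open star of vertex 1.\<close>

lemma rp2_count_even:
  "even (rp2_count {2, 3, 5})" "even (rp2_count {3, 4, 6})" "even (rp2_count {2, 4, 5})"
  "even (rp2_count {3, 5, 6})" "even (rp2_count {2, 4, 6})"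
  by (simp_all add: rp2_count_def rp2_edges_def)

text \<open>The coboundary of a coboundary vanishes modulo 2: an edge inside a 4-set lies in exactly
  two of its triples. Exchanging the sums over edges and over removed vertices yields an even
  total.\<close>

lemma even_card_odd_rp2_count:
  assumes "card \<tau> = 4"
  shows "even (card {j \<in> \<tau>. odd (rp2_count (\<tau> - {j}))})"
proof -
  have fin: "finite \<tau>" using assms by (auto intro: card_ge_0_finite)
  have "even (\<Sum>j\<in>\<tau>. of_bool (a \<in> \<tau> - {j} \<and> b \<in> \<tau> - {j}) :: nat)" if "(a, b) \<in> rp2_edges" for a b
  proof (cases "a \<in> \<tau> \<and> b \<in> \<tau>")
    case True
    have "a \<noteq> b" using that by (auto simp: rp2_edges_def)
    have "(\<Sum>j\<in>\<tau>. of_bool (a \<in> \<tau> - {j} \<and> b \<in> \<tau> - {j})) = (\<Sum>j\<in>\<tau>. of_bool (j \<in> \<tau> - {a, b}))"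
      using True by (intro sum.cong) auto
    also have "\<dots> = card (\<tau> - {a, b})"
      using fin by (simp add: sum.If_cases of_bool_def Int_def Diff_eq)
    also have "\<dots> = 2" using True \<open>a \<noteq> b\<close> assms fin by (simp add: card_Diff_subset)
    finally show ?thesis by simp
  qed auto
  then have "even (\<Sum>(a, b)\<in>rp2_edges. \<Sum>j\<in>\<tau>. of_bool (a \<in> \<tau> - {j} \<and> b \<in> \<tau> - {j}) :: nat)"
    by (intro dvd_sum) auto
  also have "(\<Sum>(a, b)\<in>rp2_edges. \<Sum>j\<in>\<tau>. of_bool (a \<in> \<tau> - {j} \<and> b \<in> \<tau> - {j}) :: nat) =
      (\<Sum>j\<in>\<tau>. rp2_count (\<tau> - {j}))"
    unfolding rp2_count_def case_prod_beta by (rule sum.swap)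
  finally show ?thesis using fin by (simp add: even_sum_iff)
qed

section \<open>Joining the triples with the top vertices\<close>

text \<open>The join with one fixed block raises triples to larger sets and keeps the relations
  between them. The block sits above \<open>m\<close> so that no signs change.\<close>

definition rp2_family :: "nat \<Rightarrow> nat \<Rightarrow> nat set set" where
  "rp2_family n m = (\<lambda>\<sigma>. \<sigma> \<union> {m + 1..n}) ` rp2_triples m"

lemma union_top_mem:
  assumes "m \<le> n" "\<tau> \<in> subsets_of_card m q"
  shows "\<tau> \<union> {m + 1..n} \<in> subsets_of_card n (q + (n - m))"
proof -
  have "finite \<tau>" using assms(2) by (rule subsets_of_card_finite)
  moreover have "\<tau> \<inter> {m + 1..n} = {}" using assms(2) by (auto simp: subsets_of_card_iff)
  ultimately have "card (\<tau> \<union> {m + 1..n}) = q + (n - m)"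
    using assms by (simp add: card_Un_disjoint subsets_of_card_iff)
  then show ?thesis using assms by (auto simp: subsets_of_card_iff)
qed

lemma rp2_family_subset: "m \<le> n \<Longrightarrow> rp2_family n m \<subseteq> subsets_of_card n (3 + (n - m))"
  using union_top_mem[of m n _ 3] by (auto simp: rp2_family_def rp2_triples_def)

lemma rp2_family_iff:
  assumes "\<sigma> \<subseteq> {1..m}"
  shows "\<sigma> \<union> {m + 1..n} \<in> rp2_family n m \<longleftrightarrow> \<sigma> \<in> rp2_triples m"
proof -
  have "\<sigma> = \<rho>" if "\<sigma> \<union> {m + 1..n} = \<rho> \<union> {m + 1..n}" "\<rho> \<in> rp2_triples m" for \<rho>
  proof -
    have "\<rho> \<subseteq> {1..m}" using that(2) by (simp add: rp2_triples_def subsets_of_card_iff)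
    then have "\<sigma> \<inter> {m + 1..n} = {}" "\<rho> \<inter> {m + 1..n} = {}" using assms by auto
    then show ?thesis using that(1) by blast
  qed
  then show ?thesis by (auto simp: rp2_family_def)
qed

text \<open>Removing a vertex of the block leaves the support, so only the removal of vertices of
  \<open>\<tau>\<close> contributes. The block lies above \<open>\<tau>\<close>, so their positions,
  and hence the signs, are the same on both sides.\<close>

lemma (in cring) coboundary_union_top:
  assumes \<tau>: "\<tau> \<subseteq> {1..m}" and c: "\<And>\<rho>. c \<rho> \<in> carrier R"
    and top: "\<And>\<rho>. \<not> {m + 1..n} \<subseteq> \<rho> \<Longrightarrow> c \<rho> = \<zero>"
  shows "coboundary R c (\<tau> \<union> {m + 1..n}) = coboundary R (\<lambda>\<sigma>. c (\<sigma> \<union> {m + 1..n})) \<tau>"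
proof -
  let ?A = "{m + 1..n}"
  have fin: "finite \<tau>" using \<tau> finite_subset by blast
  have "coboundary R c (\<tau> \<union> ?A) =
      (\<Oplus>j\<in>\<tau>. sgn_pow (card {s \<in> \<tau> \<union> ?A. s < j}) \<otimes> c (\<tau> \<union> ?A - {j}))"
    unfolding coboundary_def
  proof (rule finsum_support)
    fix j assume "j \<in> \<tau> \<union> ?A - \<tau>"
    then have "\<not> ?A \<subseteq> \<tau> \<union> ?A - {j}" by blast
    then show "sgn_pow (card {s \<in> \<tau> \<union> ?A. s < j}) \<otimes> c (\<tau> \<union> ?A - {j}) = \<zero>" by (simp add: top)
  qed (use fin c in auto)
  also have "\<dots> = coboundary R (\<lambda>\<sigma>. c (\<sigma> \<union> ?A)) \<tau>"
    unfolding coboundary_def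
  proof (rule finsum_cong')
    fix j assume j: "j \<in> \<tau>"
    then have "j \<le> m" using \<tau> by auto
    then have "{s \<in> \<tau> \<union> ?A. s < j} = {s \<in> \<tau>. s < j}" "\<tau> \<union> ?A - {j} = \<tau> - {j} \<union> ?A" by auto
    then show "sgn_pow (card {s \<in> \<tau> \<union> ?A. s < j}) \<otimes> c (\<tau> \<union> ?A - {j}) =
      sgn_pow (card {s \<in> \<tau>. s < j}) \<otimes> c (\<tau> - {j} \<union> ?A)" by (simp only:)
  qed (use c in auto)
  finally show ?thesis .
qed

lemma rp2_family_top: "\<rho> \<in> rp2_family n m \<Longrightarrow> {m + 1..n} \<subseteq> \<rho>"
  by (auto simp: rp2_family_def)

text \<open>If 1 + 1 = 0, signs disappear and the indicator function of the family is a cocycle: its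
  coboundary counts the odd triples in a 4-set, and their number is even.\<close>

lemma (in cring) rp2_family_dependent:
  assumes m: "6 \<le> m" "m \<le> n" and two: "\<one> \<oplus> \<one> = \<zero>" and nz: "\<one> \<noteq> \<zero>"
  shows "rows_dependent R n (3 + (n - m)) (rp2_family n m)"
proof -
  let ?A = "{m + 1..n}"
  define c where "c \<rho> = (if \<rho> \<in> rp2_family n m then \<one> else \<zero>)" for \<rho>
  have c: "c \<rho> \<in> carrier R" for \<rho> by (simp add: c_def)
  have top: "c \<rho> = \<zero>" if "\<not> ?A \<subseteq> \<rho>" for \<rho>
    using that rp2_family_top by (auto simp: c_def)
  have "\<ominus> \<one> = \<one>" using two by (intro minus_equality) auto
  then have sgn: "sgn_pow k = \<one>" for k by simp
  have "c \<in> cocycles R n (3 + (n - m)) (rp2_family n m)"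
  proof (rule cocyclesI)
    fix \<tau> assume \<tau>: "\<tau> \<in> subsets_of_card n (3 + (n - m) + 1)"
    show "coboundary R c \<tau> = \<zero>"
    proof (cases "?A \<subseteq> \<tau>")
      case False
      \<comment> \<open>No facet of \<open>\<tau>\<close> contains the block.\<close>
      then have "c (\<tau> - {j}) = \<zero>" for j by (intro top) auto
      then show ?thesis unfolding coboundary_def by (intro add.finprod_one_eqI) simp
    next
      case True
      define \<tau>\<^sub>0 where "\<tau>\<^sub>0 = \<tau> - ?A"
      have \<tau>0: "\<tau> = \<tau>\<^sub>0 \<union> ?A" "\<tau>\<^sub>0 \<subseteq> {1..m}"
        using True \<tau> by (auto simp: \<tau>\<^sub>0_def subsets_of_card_iff)
      have "card \<tau>\<^sub>0 = 4"
        using \<tau> True m unfolding \<tau>\<^sub>0_def by (subst card_Diff_subset) (auto simp: subsets_of_card_iff)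
      then have fin: "finite \<tau>\<^sub>0" and ev: "even (card {j \<in> \<tau>\<^sub>0. odd (rp2_count (\<tau>\<^sub>0 - {j}))})"
        using even_card_odd_rp2_count by (auto intro: card_ge_0_finite)
      let ?J = "{j \<in> \<tau>\<^sub>0. odd (rp2_count (\<tau>\<^sub>0 - {j}))}"
      have mem: "\<tau>\<^sub>0 - {j} \<union> ?A \<in> rp2_family n m \<longleftrightarrow> j \<in> ?J" if "j \<in> \<tau>\<^sub>0" for j
      proof -
        have "\<tau>\<^sub>0 - {j} \<in> subsets_of_card m 3"
          using that fin \<tau>0(2) \<open>card \<tau>\<^sub>0 = 4\<close> by (auto simp: subsets_of_card_iff)
        then show ?thesis using that by (subst rp2_family_iff) (auto simp: rp2_triples_def subsets_of_card_iff)
      qed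
      have "coboundary R c \<tau> = coboundary R (\<lambda>\<sigma>. c (\<sigma> \<union> ?A)) \<tau>\<^sub>0"
        unfolding \<tau>0(1) by (rule coboundary_union_top[OF \<tau>0(2) c top])
      also have "\<dots> = (\<Oplus>j\<in>\<tau>\<^sub>0. c (\<tau>\<^sub>0 - {j} \<union> ?A))"
        unfolding coboundary_def by (rule finsum_cong') (simp_all add: sgn c)
      also have "\<dots> = (\<Oplus>j\<in>?J. c (\<tau>\<^sub>0 - {j} \<union> ?A))"
        by (rule finsum_support) (use fin mem c in \<open>auto simp: c_def\<close>)
      also have "\<dots> = (\<Oplus>j\<in>?J. \<one>)"
        by (rule finsum_cong') (use mem in \<open>auto simp: c_def\<close>)
      also have "\<dots> = [card ?J] \<cdot> \<one>" by (rule add.finprod_const) simp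
      also have "\<dots> = \<zero>"
      proof -
        obtain k where k: "card ?J = 2 * k" using ev by (rule evenE)
        have "[(2::nat)] \<cdot> \<one> = \<zero>" using two by (simp add: numeral_2_eq_2)
        then have "[k] \<cdot> ([(2::nat)] \<cdot> \<one>) = \<zero>" by simp
        then show ?thesis unfolding k by (simp add: add.nat_pow_pow)
      qed
      finally show ?thesis .
    qed
  qed (auto simp: c_def split: if_splits)
  \<comment> \<open>The pair 2, 4 is a chord, so its triple with vertex 1 shows that the indicator
    function is not zero.\<close>
  moreover have "{1, 2, 4} \<in> rp2_triples m"
    using m rp2_count_cone[of 2 4] by (auto simp: rp2_triples_def subsets_of_card_iff rp2_edges_def)
  then have "{1, 2, 4} \<union> ?A \<in> rp2_family n m" unfolding rp2_family_def by (rule imageI)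
  then have "c ({1, 2, 4} \<union> ?A) \<noteq> \<zero>" using nz unfolding c_def by simp
  ultimately show ?thesis
    using rows_dependent_iff[OF rp2_family_subset[OF m(2)]] by blast
qed

lemma (in domain) rp2_family_independent:
  assumes m: "6 \<le> m" "m \<le> n" and two: "\<one> \<oplus> \<one> \<noteq> \<zero>"
  shows "\<not> rows_dependent R n (3 + (n - m)) (rp2_family n m)"
proof
  let ?A = "{m + 1..n}"
  assume "rows_dependent R n (3 + (n - m)) (rp2_family n m)"
  then obtain c \<rho> where c: "c \<in> cocycles R n (3 + (n - m)) (rp2_family n m)" and \<rho>: "c \<rho> \<noteq> \<zero>"
    using rows_dependent_iff[OF rp2_family_subset[OF m(2)]] by blast
  note cc = cocycles_carrier[OF c]
  define f where "f \<sigma> = c (\<sigma> \<union> ?A)" for \<sigma>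
  have f: "f \<sigma> \<in> carrier R" for \<sigma> by (simp add: f_def cc)
  have f_zero: "f \<sigma> = \<zero>" if "\<sigma> \<subseteq> {1..m}" "even (rp2_count \<sigma>)" for \<sigma>
  proof -
    have "\<sigma> \<union> ?A \<notin> rp2_family n m"
      unfolding rp2_family_iff[OF that(1)] using that(2) by (simp add: rp2_triples_def)
    then show ?thesis using cocycles_support[OF c] unfolding f_def by blast
  qed
  have top: "c \<rho> = \<zero>" if "\<not> ?A \<subseteq> \<rho>" for \<rho>
    using that rp2_family_top[of \<rho> n m] cocycles_support[OF c, of \<rho>] by blast
  \<comment> \<open>The column joining vertex 1 to a triple expresses the value there by the three
    triples through vertex 1.\<close>
  have rel: "f {j, k, l} = f {1, k, l} \<ominus> f {1, j, l} \<oplus> f {1, j, k}"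
    if "1 < j" "j < k" "k < l" "l \<le> m" for j k l
  proof -
    let ?\<tau> = "{1, j, k, l}"
    have "?\<tau> \<in> subsets_of_card m 4" using that by (simp add: subsets_of_card_iff)
    then have "?\<tau> \<union> ?A \<in> subsets_of_card n (4 + (n - m))" by (rule union_top_mem[OF m(2)])
    then have "coboundary R c (?\<tau> \<union> ?A) = \<zero>"
      by (intro cocycles_coboundary[OF c]) (simp add: add.commute)
    moreover have "coboundary R c (?\<tau> \<union> ?A) = coboundary R f ?\<tau>"
      unfolding f_def by (rule coboundary_union_top[OF _ cc top]) (use that in auto)
    moreover have "coboundary R f ?\<tau> = f {j, k, l} \<ominus> f {1, k, l} \<oplus> f {1, j, l} \<ominus> f {1, j, k}"
      by (rule coboundary_4) (use that f in auto)
    ultimately have z: "f {j, k, l} \<ominus> f {1, k, l} \<oplus> f {1, j, l} \<ominus> f {1, j, k} = \<zero>"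
      by (simp only:)
    have "f {j, k, l} = (f {j, k, l} \<ominus> f {1, k, l} \<oplus> f {1, j, l} \<ominus> f {1, j, k}) \<oplus>
        (f {1, k, l} \<ominus> f {1, j, l} \<oplus> f {1, j, k})"
      using f[of "{j, k, l}"] f[of "{1, k, l}"] f[of "{1, j, l}"] f[of "{1, j, k}"] by algebra
    then show ?thesis unfolding z using f by simp
  qed
  define g where "g j k = f {1, j, k}" for j k
  have g: "g j k \<in> carrier R" for j k by (simp add: g_def f)
  have g_zero: "g j k = \<zero>" if "1 < j" "j < k" "k \<le> m" "(j, k) \<notin> rp2_edges" for j k
    unfolding g_def using that rp2_count_cone[of j k] by (intro f_zero) auto
  have tri: "g k l \<ominus> g j l \<oplus> g j k = \<zero>"
    if "1 < j" "j < k" "k < l" "l \<le> m" "even (rp2_count {j, k, l})" for j k l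
    unfolding g_def rel[OF that(1-4), symmetric] using that by (intro f_zero) auto
  \<comment> \<open>The sides of the 5-cycle are not chords.\<close>
  have ne: "g 2 3 = \<zero>" "g 3 4 = \<zero>" "g 4 5 = \<zero>" "g 5 6 = \<zero>" "g 2 6 = \<zero>"
    using m by (intro g_zero; simp add: rp2_edges_def)+
  \<comment> \<open>One relation per triangle of the band. In the first four the two chords have
    opposite signs, which makes all five values equal. In \<open>{2, 4, 6}\<close> they have the
    same sign; this is where non-orientability enters.\<close>
  have "g 3 5 \<ominus> g 2 5 \<oplus> g 2 3 = \<zero>" "g 4 6 \<ominus> g 3 6 \<oplus> g 3 4 = \<zero>" "g 4 5 \<ominus> g 2 5 \<oplus> g 2 4 = \<zero>"
    "g 5 6 \<ominus> g 3 6 \<oplus> g 3 5 = \<zero>" "g 4 6 \<ominus> g 2 6 \<oplus> g 2 4 = \<zero>"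
    using m by (intro tri rp2_count_even; simp)+
  then have "g 3 5 \<ominus> g 2 5 = \<zero>" "g 4 6 \<ominus> g 3 6 = \<zero>" "g 2 4 \<ominus> g 2 5 = \<zero>"
    "g 3 5 \<ominus> g 3 6 = \<zero>" and sum0: "g 4 6 \<oplus> g 2 4 = \<zero>"
    using ne g by (simp_all add: a_minus_def a_comm)
  then have eqs: "g 3 5 = g 2 4" "g 2 5 = g 2 4" "g 3 6 = g 2 4" "g 4 6 = g 2 4"
    using g by simp_all
  have "(\<one> \<oplus> \<one>) \<otimes> g 2 4 = \<zero>" using sum0 eqs(4) g by (simp add: l_distr)
  then have "g 2 4 = \<zero>" using two g integral by blast
  then have "g j k = \<zero>" if "(j, k) \<in> rp2_edges" for j k
    using that eqs by (auto simp: rp2_edges_def)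
  then have g0: "g j k = \<zero>" if "1 < j" "j < k" "k \<le> m" for j k
    using that g_zero by blast
  \<comment> \<open>Triples through vertex 1 are covered by \<open>g0\<close>, the others follow by
    \<open>rel\<close>.\<close>
  have f0: "f \<sigma> = \<zero>" if \<sigma>: "\<sigma> \<in> subsets_of_card m 3" for \<sigma>
  proof -
    obtain i j k where ijk: "1 \<le> i" "i < j" "j < k" "k \<le> m" "\<sigma> = {i, j, k}"
      using \<sigma> by (rule subsets_of_card_3E)
    show ?thesis
    proof (cases "i = 1")
      case True
      then show ?thesis using g0[of j k] ijk by (simp add: g_def)
    next
      case False
      then show ?thesis
        using rel[of i j k] ijk g0[of j k] g0[of i k] g0[of i j] by (simp add: g_def a_minus_def)
    qed
  qed
  have "\<rho> \<in> rp2_family n m" using c \<rho> by (rule cocycles_support)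
  then obtain \<sigma> where "\<sigma> \<in> rp2_triples m" "\<rho> = \<sigma> \<union> ?A" unfolding rp2_family_def by blast
  then show False using f0[of \<sigma>] \<rho> by (simp add: f_def rp2_triples_def)
qed

section \<open>Characteristic two and the two halves of the theorem\<close>

text \<open>This tells two characteristics apart while computing only one of them. Since 1 is
  nonzero in a domain, the multiple 2 is the least possible.\<close>

lemma (in domain) ring_char_eq_2_iff: "ring_char R = 2 \<longleftrightarrow> \<one> \<oplus> \<one> = \<zero>"
proof
  assume "ring_char R = 2"
  then have ex: "\<exists>m>0. [(m::nat)] \<cdot> \<one> = \<zero>"
    and least: "(LEAST m. m > 0 \<and> [(m::nat)] \<cdot> \<one> = \<zero>) = 2"
    by (auto simp: ring_char_def split: if_splits)
  have "[(2::nat)] \<cdot> \<one> = \<zero>" using LeastI_ex[OF ex] unfolding least by blast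
  then show "\<one> \<oplus> \<one> = \<zero>" by (simp add: numeral_2_eq_2)
next
  assume "\<one> \<oplus> \<one> = \<zero>"
  then have two: "[(2::nat)] \<cdot> \<one> = \<zero>" by (simp add: numeral_2_eq_2)
  have "(LEAST m. m > 0 \<and> [(m::nat)] \<cdot> \<one> = \<zero>) = 2"
  proof (rule Least_equality)
    fix m :: nat assume m: "m > 0 \<and> [m] \<cdot> \<one> = \<zero>"
    have "m \<noteq> 1" using m by auto
    then show "2 \<le> m" using m by simp
  qed (use two in simp)
  then show "ring_char R = 2" using two by (auto simp: ring_char_def intro: exI[of _ 2])
qed

lemma residue_field: "prime p \<Longrightarrow> field (residue_ring (int p))"
  by (intro residues_prime.is_field residues_prime.intro)

theorem proposition3p10:
  fixes n p :: nat
  assumes "1 \<le> p" and "p \<le> n"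
  shows
    "(p \<in> {1, 2, n - 2, n - 1, n} \<longrightarrow>
        (\<forall>(K :: 'a ring) (L :: 'b ring). field K \<and> field L \<longrightarrow> circuits K n p = circuits L n p))
     \<and>
     (3 \<le> p \<and> p \<le> n - 3 \<longrightarrow>
        (\<exists>(K :: int ring) (L :: int ring).
           field K \<and> field L \<and> ring_char K \<noteq> ring_char L \<and> circuits K n p \<noteq> circuits L n p))"
proof (intro conjI impI allI)
  fix K :: "'a ring" and L :: "'b ring"
  assume p: "p \<in> {1, 2, n - 2, n - 1, n}" and "field K \<and> field L"
  then interpret K: field K + L: field L by auto
  consider "p = 1" | "p = 2" | "p = n - 2" | "p = n - 1" | "p = n" using p by blast
  then show "circuits K n p = circuits L n p"
  proof cases
    case 1
    then show ?thesis
      using K.rows_dependent_1[of n] L.rows_dependent_1[of n] assms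
      by (auto intro!: circuits_cong)
  next
    case 2
    then show ?thesis
      using K.rows_dependent_2[of _ n] L.rows_dependent_2[of _ n] by (auto intro!: circuits_cong)
  next
    case 3
    \<comment> \<open>Subtraction truncates: for \<open>n \<le> 2\<close> this case would give
      \<open>p = 0\<close>, against \<open>1 \<le> p\<close>.\<close>
    moreover have "2 \<le> n" using 3 assms by simp
    ultimately show ?thesis
      using K.rows_dependent_corank_2[of n] L.rows_dependent_corank_2[of n]
      by (auto intro!: circuits_cong)
  next
    case 4
    then show ?thesis
      using K.rows_dependent_corank_1[of n] L.rows_dependent_corank_1[of n] assms
      by (auto intro!: circuits_cong)
  next
    case 5
    then show ?thesis using circuits_top K.field_axioms L.field_axioms by metis
  qed
next
  assume p: "3 \<le> p \<and> p \<le> n - 3"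
  \<comment> \<open>With this choice a triple joined with the \<open>n - m\<close> top vertices has
    \<open>p\<close> elements. The bound \<open>p \<le> n - 3\<close> leaves room for the six
    vertices, and \<open>3 \<le> p\<close> gives \<open>m \<le> n\<close>.\<close>
  define m where "m = n - p + 3"
  have m: "6 \<le> m" "m \<le> n" "3 + (n - m) = p" using p by (auto simp: m_def)
  let ?K = "residue_ring 2" and ?L = "residue_ring 3"
  have fields: "field ?K" "field ?L"
    using residue_field[of 2] residue_field[of 3] by simp_all
  interpret K: field ?K by (rule fields)
  interpret L: field ?L by (rule fields)
  have two: "\<one>\<^bsub>?K\<^esub> \<oplus>\<^bsub>?K\<^esub> \<one>\<^bsub>?K\<^esub> = \<zero>\<^bsub>?K\<^esub>" "\<one>\<^bsub>?L\<^esub> \<oplus>\<^bsub>?L\<^esub> \<one>\<^bsub>?L\<^esub> \<noteq> \<zero>\<^bsub>?L\<^esub>"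
    by (simp_all add: residue_ring_def)
  have "ring_char ?K \<noteq> ring_char ?L"
    using K.ring_char_eq_2_iff L.ring_char_eq_2_iff two by metis
  moreover have "circuits ?K n p \<noteq> circuits ?L n p"
  proof
    assume eq: "circuits ?K n p = circuits ?L n p"
    have sub: "rp2_family n m \<subseteq> subsets_of_card n p" using rp2_family_subset m by metis
    have "rows_dependent ?K n p (rp2_family n m)"
      using K.rp2_family_dependent[OF m(1,2) two(1) K.one_not_zero] m(3) by simp
    \<comment> \<open>Equal circuits would carry the dependence over to the field with three
      elements.\<close>
    then have "rows_dependent ?L n p (rp2_family n m)"
      unfolding K.rows_dependent_iff_circuit[OF sub] L.rows_dependent_iff_circuit[OF sub] eq .
    then show False using L.rp2_family_independent[OF m(1,2) two(2)] m(3) by simp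
  qed
  ultimately show "\<exists>(K :: int ring) (L :: int ring).
      field K \<and> field L \<and> ring_char K \<noteq> ring_char L \<and> circuits K n p \<noteq> circuits L n p"
    using fields by blast
qed

end
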